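(* Let $(\mathcal{V},\otimes,I,c)$ be a braided monoidal category and let $*\colon\mathcal{V}\times\mathcal{A}\to\mathcal{A}$ be a left action of $\mathcal{V}$ on a monoidal category $(\mathcal{A},\diamond,J)$ such that $(-*A)$ has a right adjoint for all $A\in\mathcal{A}$. Let $\underline{\mathcal{A}}$ be the associated $\mathcal{V}$-category. Then each opmonoidal structure on the action induces a monoidal $\mathcal{V}$-category structure on $\underline{\mathcal{A}}$ with underlying monoidal category $\mathcal{A}$.
   Context: A left action consists of a functor $*$ and coherent natural isomorphisms $\alpha_{XYA}\colon X*(Y*A)\to(X\otimes Y)*A$ and $\lambda_A\colon I*A\to A$. If each $(-*A)$ has a right adjoint $\underline{\mathcal{A}}(A,-)$, these are the hom-objects of a $\mathcal{V}$-category $\underline{\mathcal{A}}$ with underlying category $\mathcal{A}$; composition $\underline{\mathcal{A}}(B,C)\otimes\underline{\mathcal{A}}(A,B)\to\underline{\mathcal{A}}(A,C)$ and identities $I\to\underline{\mathcal{A}}(A,A)$ are the transposes of the evident composites of $\alpha^{-1}$ and the counits $\epsilon\colon\underline{\mathcal{A}}(A,B)*A\to B$, and of $\lambda_A$. An opmonoidal structure on the action is an opmonoidal (oplax monoidal) structure on the functor $*\colon\mathcal{V}\times\mathcal{A}\to\mathcal{A}$, i.e. a morphism $\xi_0\colon I*J\to J$ and a natural transformation $\xi_{XYAB}\colon(X\otimes Y)*(A\diamond B)\to(X*A)\diamond(Y*B)$ satisfying the usual associativity and unit axioms, such that $\alpha$ and $\lambda$ are opmonoidal natural transformations. Explicitly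 (associativities suppressed, $l_I\colon I\otimes I\cong I$): - $(\alpha\diamond\alpha)\cdot\xi_{X,X',Y*A,Y'*A'}\cdot(1*\xi_{YY'AA'})=\xi_{X\otimes Y,X'\otimes Y',A,A'}\cdot((1\otimes c_{X',Y}\otimes 1)*1)\cdot\alpha$; - $\xi_0\cdot(1*\xi_0)=\xi_0\cdot(l_I*1)\cdot\alpha_{IIJ}$; - $(\lambda_A\diamond\lambda_B)\cdot\xi_{IIAB}=\lambda_{A\diamond B}\cdot(l_I*1)$; - $\xi_0=\lambda_J$. A monoidal $\mathcal{V}$-category is a $\mathcal{V}$-category $\mathcal{B}$ with a $\mathcal{V}$-functor $\mathcal{B}\otimes\mathcal{B}\to\mathcal{B}$, a unit object and $\mathcal{V}$-natural associativity and unit isomorphisms which form a monoidal structure on the underlying category; here $(\mathcal{B}\otimes\mathcal{B})((A,B),(C,D))=\mathcal{B}(A,C)\otimes\mathcal{B}(B,D)$, with composition using $c$. The induced structure on $\underline{\mathcal{A}}$ is the one whose tensor $\mathcal{V}$-functor $T$ is $\diamond$ on objects and on homs is the morphism $\underline{\mathcal{A}}(A,C)\otimes\underline{\mathcal{A}}(B,D)\to\underline{\mathcal{A}}(A\diamond B,C\diamond D)$ transpose to $(\epsilon\diamond\epsilon)\cdot\xi$, with unit $J$ and the associativity and unit constraints of $\mathcal{A}$. *)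

theory Defs
  imports Main
begin

section \<open>Categories and functors\<close>

text \<open>
  A category has carrier sets of objects and arrows inside arbitrary types; all operations are
  unconstrained outside these carriers. Composition is written in the classical order.
\<close>

record ('o, 'm) category_data =
  Obj :: "'o set"
  Arr :: "'m set"
  Dom :: "'m \<Rightarrow> 'o"
  Cod :: "'m \<Rightarrow> 'o"
  Ide :: "'o \<Rightarrow> 'm" ("\<i>\<index>")
  Comp :: "'m \<Rightarrow> 'm \<Rightarrow> 'm" (infixr "\<cdot>\<index>" 65)

definition hom :: "('o, 'm, 'x) category_data_scheme \<Rightarrow> 'o \<Rightarrow> 'o \<Rightarrow> 'm set" where
  "hom C a b = {f \<in> Arr C. Dom C f = a \<and> Cod C f = b}"

locale category =
  fixes C :: "('o, 'm, 'x) category_data_scheme" (structure)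
  assumes Dom_Obj: "f \<in> Arr C \<Longrightarrow> Dom C f \<in> Obj C"
    and Cod_Obj: "f \<in> Arr C \<Longrightarrow> Cod C f \<in> Obj C"
    and Ide_hom: "a \<in> Obj C \<Longrightarrow> \<i> a \<in> hom C a a"
    and Comp_hom: "\<lbrakk>f \<in> hom C a b; g \<in> hom C b c\<rbrakk> \<Longrightarrow> g \<cdot> f \<in> hom C a c"
    and Comp_Ide: "f \<in> hom C a b \<Longrightarrow> f \<cdot> \<i> a = f"
    and Ide_Comp: "f \<in> hom C a b \<Longrightarrow> \<i> b \<cdot> f = f"
    and Comp_assoc: "\<lbrakk>f \<in> hom C a b; g \<in> hom C b c; h \<in> hom C c d\<rbrakk>
      \<Longrightarrow> (h \<cdot> g) \<cdot> f = h \<cdot> (g \<cdot> f)"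

definition inverse_arrows :: "('o, 'm, 'x) category_data_scheme \<Rightarrow> 'm \<Rightarrow> 'm \<Rightarrow> bool" where
  "inverse_arrows C f g \<longleftrightarrow>
     f \<in> Arr C \<and> g \<in> hom C (Cod C f) (Dom C f) \<and>
     Comp C g f = Ide C (Dom C f) \<and> Comp C f g = Ide C (Cod C f)"

definition iso :: "('o, 'm, 'x) category_data_scheme \<Rightarrow> 'm \<Rightarrow> bool" where
  "iso C f \<longleftrightarrow> (\<exists>g. inverse_arrows C f g)"

definition inv_arr :: "('o, 'm, 'x) category_data_scheme \<Rightarrow> 'm \<Rightarrow> 'm" where
  "inv_arr C f = (THE g. inverse_arrows C f g)"

definition product_category ::
  "('o, 'm, 'x) category_data_scheme \<Rightarrow> ('p, 'n, 'y) category_data_scheme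
    \<Rightarrow> ('o \<times> 'p, 'm \<times> 'n) category_data" where
  "product_category C D =
    \<lparr>Obj = Obj C \<times> Obj D,
     Arr = Arr C \<times> Arr D,
     Dom = (\<lambda>(f, g). (Dom C f, Dom D g)),
     Cod = (\<lambda>(f, g). (Cod C f, Cod D g)),
     Ide = (\<lambda>(a, b). (Ide C a, Ide D b)),
     Comp = (\<lambda>(f', g') (f, g). (Comp C f' f, Comp D g' g))\<rparr>"

record ('o, 'm, 'p, 'n) functor_data =
  onObj :: "'o \<Rightarrow> 'p"
  onArr :: "'m \<Rightarrow> 'n"

locale cat_functor =
  dom: category C + cod: category D
  for C :: "('o, 'm, 'x) category_data_scheme"
    and D :: "('p, 'n, 'y) category_data_scheme"
    and F :: "('o, 'm, 'p, 'n) functor_data" +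
  assumes onObj: "a \<in> Obj C \<Longrightarrow> onObj F a \<in> Obj D"
    and onArr: "f \<in> hom C a b \<Longrightarrow> onArr F f \<in> hom D (onObj F a) (onObj F b)"
    and onArr_Ide: "a \<in> Obj C \<Longrightarrow> onArr F (Ide C a) = Ide D (onObj F a)"
    and onArr_Comp: "\<lbrakk>f \<in> hom C a b; g \<in> hom C b c\<rbrakk>
      \<Longrightarrow> onArr F (Comp C g f) = Comp D (onArr F g) (onArr F f)"

definition bifunctor_data ::
  "('o \<Rightarrow> 'p \<Rightarrow> 'q) \<Rightarrow> ('m \<Rightarrow> 'n \<Rightarrow> 'r) \<Rightarrow> ('o \<times> 'p, 'm \<times> 'n, 'q, 'r) functor_data" where
  "bifunctor_data tO tA = \<lparr>onObj = (\<lambda>(a, b). tO a b), onArr = (\<lambda>(f, g). tA f g)\<rparr>"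

record ('o, 'm, 'p, 'n) right_adjoint_data =
  RightAdj :: "('p, 'n, 'o, 'm) functor_data"
  Unit :: "'o \<Rightarrow> 'm"
  Counit :: "'p \<Rightarrow> 'n"

locale adjunction =
  left: cat_functor C D F + right: cat_functor D C "RightAdj R"
  for C :: "('o, 'm, 'x) category_data_scheme"
    and D :: "('p, 'n, 'y) category_data_scheme"
    and F :: "('o, 'm, 'p, 'n) functor_data"
    and R :: "('o, 'm, 'p, 'n) right_adjoint_data" +
  assumes Unit_hom: "x \<in> Obj C
      \<Longrightarrow> Unit R x \<in> hom C x (onObj (RightAdj R) (onObj F x))"
    and Unit_natural: "f \<in> hom C x x'
      \<Longrightarrow> Unit R x' \<cdot>\<^bsub>C\<^esub> f = onArr (RightAdj R) (onArr F f) \<cdot>\<^bsub>C\<^esub> Unit R x"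
    and Counit_hom: "y \<in> Obj D
      \<Longrightarrow> Counit R y \<in> hom D (onObj F (onObj (RightAdj R) y)) y"
    and Counit_natural: "g \<in> hom D y y'
      \<Longrightarrow> Counit R y' \<cdot>\<^bsub>D\<^esub> onArr F (onArr (RightAdj R) g) = g \<cdot>\<^bsub>D\<^esub> Counit R y"
    and triangle_left: "x \<in> Obj C
      \<Longrightarrow> Counit R (onObj F x) \<cdot>\<^bsub>D\<^esub> onArr F (Unit R x) = \<i>\<^bsub>D\<^esub> (onObj F x)"
    and triangle_right: "y \<in> Obj D
      \<Longrightarrow> onArr (RightAdj R) (Counit R y) \<cdot>\<^bsub>C\<^esub> Unit R (onObj (RightAdj R) y)
          = \<i>\<^bsub>C\<^esub> (onObj (RightAdj R) y)"

text \<open>The transpose \<open>x \<rightarrow> R y\<close> of an arrow \<open>f : F x \<rightarrow> y\<close>.\<close>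

definition transpose ::
  "('o, 'm, 'x) category_data_scheme \<Rightarrow> ('o, 'm, 'p, 'n) right_adjoint_data
    \<Rightarrow> 'o \<Rightarrow> 'n \<Rightarrow> 'm" where
  "transpose C R x f = onArr (RightAdj R) f \<cdot>\<^bsub>C\<^esub> Unit R x"


section \<open>Monoidal and braided monoidal categories\<close>

text \<open>
  The symbol \<open>\<otimes>\<close> is the tensor product of objects and \<open>\<boxtimes>\<close> that of arrows. The constraints have
  the directions \<open>(a \<otimes> b) \<otimes> c \<rightarrow> a \<otimes> (b \<otimes> c)\<close>, \<open>I \<otimes> a \<rightarrow> a\<close> and \<open>a \<otimes> I \<rightarrow> a\<close>.
\<close>

record ('o, 'm) monoidal_data = "('o, 'm) category_data" +
  TensO :: "'o \<Rightarrow> 'o \<Rightarrow> 'o" (infixr "\<otimes>\<index>" 75)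
  TensA :: "'m \<Rightarrow> 'm \<Rightarrow> 'm" (infixr "\<boxtimes>\<index>" 75)
  UnitO :: "'o" ("\<I>\<index>")
  Assoc :: "'o \<Rightarrow> 'o \<Rightarrow> 'o \<Rightarrow> 'm" ("\<a>\<index>")
  LUnit :: "'o \<Rightarrow> 'm" ("\<l>\<index>")
  RUnit :: "'o \<Rightarrow> 'm" ("\<r>\<index>")

locale monoidal_category =
  category C for C :: "('o, 'm, 'x) monoidal_data_scheme" (structure) +
  assumes tensor_functor:
      "cat_functor (product_category C C) C (bifunctor_data (\<otimes>) (\<boxtimes>))"
    and UnitO_Obj: "\<I> \<in> Obj C"
    and Assoc_hom: "\<lbrakk>a \<in> Obj C; b \<in> Obj C; c \<in> Obj C\<rbrakk>
      \<Longrightarrow> \<a> a b c \<in> hom C ((a \<otimes> b) \<otimes> c) (a \<otimes> (b \<otimes> c))"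
    and Assoc_iso: "\<lbrakk>a \<in> Obj C; b \<in> Obj C; c \<in> Obj C\<rbrakk> \<Longrightarrow> iso C (\<a> a b c)"
    and Assoc_natural: "\<lbrakk>f \<in> hom C a a'; g \<in> hom C b b'; h \<in> hom C c c'\<rbrakk>
      \<Longrightarrow> \<a> a' b' c' \<cdot> ((f \<boxtimes> g) \<boxtimes> h) = (f \<boxtimes> (g \<boxtimes> h)) \<cdot> \<a> a b c"
    and LUnit_hom: "a \<in> Obj C \<Longrightarrow> \<l> a \<in> hom C (\<I> \<otimes> a) a"
    and LUnit_iso: "a \<in> Obj C \<Longrightarrow> iso C (\<l> a)"
    and LUnit_natural: "f \<in> hom C a b \<Longrightarrow> \<l> b \<cdot> (\<i> \<I> \<boxtimes> f) = f \<cdot> \<l> a"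
    and RUnit_hom: "a \<in> Obj C \<Longrightarrow> \<r> a \<in> hom C (a \<otimes> \<I>) a"
    and RUnit_iso: "a \<in> Obj C \<Longrightarrow> iso C (\<r> a)"
    and RUnit_natural: "f \<in> hom C a b \<Longrightarrow> \<r> b \<cdot> (f \<boxtimes> \<i> \<I>) = f \<cdot> \<r> a"
    and pentagon: "\<lbrakk>a \<in> Obj C; b \<in> Obj C; c \<in> Obj C; d \<in> Obj C\<rbrakk>
      \<Longrightarrow> (\<i> a \<boxtimes> \<a> b c d) \<cdot> \<a> a (b \<otimes> c) d \<cdot> (\<a> a b c \<boxtimes> \<i> d)
          = \<a> a b (c \<otimes> d) \<cdot> \<a> (a \<otimes> b) c d"
    and triangle: "\<lbrakk>a \<in> Obj C; b \<in> Obj C\<rbrakk>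
      \<Longrightarrow> (\<i> a \<boxtimes> \<l> b) \<cdot> \<a> a \<I> b = \<r> a \<boxtimes> \<i> b"

record ('o, 'm) braided_data = "('o, 'm) monoidal_data" +
  Braid :: "'o \<Rightarrow> 'o \<Rightarrow> 'm" ("\<c>\<index>")

locale braided_monoidal_category =
  monoidal_category C for C :: "('o, 'm, 'x) braided_data_scheme" (structure) +
  assumes Braid_hom: "\<lbrakk>a \<in> Obj C; b \<in> Obj C\<rbrakk> \<Longrightarrow> \<c> a b \<in> hom C (a \<otimes> b) (b \<otimes> a)"
    and Braid_iso: "\<lbrakk>a \<in> Obj C; b \<in> Obj C\<rbrakk> \<Longrightarrow> iso C (\<c> a b)"
    and Braid_natural: "\<lbrakk>f \<in> hom C a a'; g \<in> hom C b b'\<rbrakk>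
      \<Longrightarrow> \<c> a' b' \<cdot> (f \<boxtimes> g) = (g \<boxtimes> f) \<cdot> \<c> a b"
    and hexagon: "\<lbrakk>a \<in> Obj C; b \<in> Obj C; c \<in> Obj C\<rbrakk>
      \<Longrightarrow> \<a> b c a \<cdot> \<c> a (b \<otimes> c) \<cdot> \<a> a b c
          = (\<i> b \<boxtimes> \<c> a c) \<cdot> \<a> b a c \<cdot> (\<c> a b \<boxtimes> \<i> c)"
    and hexagon_inverse: "\<lbrakk>a \<in> Obj C; b \<in> Obj C; c \<in> Obj C\<rbrakk>
      \<Longrightarrow> inv_arr C (\<a> c a b) \<cdot> \<c> (a \<otimes> b) c \<cdot> inv_arr C (\<a> a b c)
          = (\<c> a c \<boxtimes> \<i> b) \<cdot> inv_arr C (\<a> a c b) \<cdot> (\<i> a \<boxtimes> \<c> b c)"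

text \<open>The interchange \<open>1 \<otimes> c \<otimes> 1 : (w \<otimes> x) \<otimes> (y \<otimes> z) \<rightarrow> (w \<otimes> y) \<otimes> (x \<otimes> z)\<close>.\<close>

definition interchange ::
  "('o, 'm, 'x) braided_data_scheme \<Rightarrow> 'o \<Rightarrow> 'o \<Rightarrow> 'o \<Rightarrow> 'o \<Rightarrow> 'm" where
  "interchange V w x y z =
     inv_arr V (\<a>\<^bsub>V\<^esub> w y (x \<otimes>\<^bsub>V\<^esub> z))
     \<cdot>\<^bsub>V\<^esub> (\<i>\<^bsub>V\<^esub> w \<boxtimes>\<^bsub>V\<^esub>
           (\<a>\<^bsub>V\<^esub> y x z \<cdot>\<^bsub>V\<^esub> (\<c>\<^bsub>V\<^esub> x y \<boxtimes>\<^bsub>V\<^esub> \<i>\<^bsub>V\<^esub> z) \<cdot>\<^bsub>V\<^esub> inv_arr V (\<a>\<^bsub>V\<^esub> x y z)))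
     \<cdot>\<^bsub>V\<^esub> \<a>\<^bsub>V\<^esub> w x (y \<otimes>\<^bsub>V\<^esub> z)"

text \<open>An isomorphism of categories preserving the monoidal structure on the nose.\<close>

locale monoidal_isomorphism =
  source: monoidal_category M + target: monoidal_category N + cat_functor M N F
  for M :: "('o, 'm, 'x) monoidal_data_scheme"
    and N :: "('p, 'n, 'y) monoidal_data_scheme"
    and F :: "('o, 'm, 'p, 'n) functor_data" +
  assumes bij_Obj: "bij_betw (onObj F) (Obj M) (Obj N)"
    and bij_Arr: "bij_betw (onArr F) (Arr M) (Arr N)"
    and onObj_Tens: "\<lbrakk>a \<in> Obj M; b \<in> Obj M\<rbrakk>
      \<Longrightarrow> onObj F (a \<otimes>\<^bsub>M\<^esub> b) = onObj F a \<otimes>\<^bsub>N\<^esub> onObj F b"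
    and onArr_Tens: "\<lbrakk>f \<in> Arr M; g \<in> Arr M\<rbrakk>
      \<Longrightarrow> onArr F (f \<boxtimes>\<^bsub>M\<^esub> g) = onArr F f \<boxtimes>\<^bsub>N\<^esub> onArr F g"
    and onObj_UnitO: "onObj F \<I>\<^bsub>M\<^esub> = \<I>\<^bsub>N\<^esub>"
    and onArr_Assoc: "\<lbrakk>a \<in> Obj M; b \<in> Obj M; c \<in> Obj M\<rbrakk>
      \<Longrightarrow> onArr F (\<a>\<^bsub>M\<^esub> a b c) = \<a>\<^bsub>N\<^esub> (onObj F a) (onObj F b) (onObj F c)"
    and onArr_LUnit: "a \<in> Obj M \<Longrightarrow> onArr F (\<l>\<^bsub>M\<^esub> a) = \<l>\<^bsub>N\<^esub> (onObj F a)"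
    and onArr_RUnit: "a \<in> Obj M \<Longrightarrow> onArr F (\<r>\<^bsub>M\<^esub> a) = \<r>\<^bsub>N\<^esub> (onObj F a)"


section \<open>Enriched categories\<close>

record ('o, 'v, 'm) Vcategory_data =
  VObj :: "'o set"
  VHom :: "'o \<Rightarrow> 'o \<Rightarrow> 'v"
  VComp :: "'o \<Rightarrow> 'o \<Rightarrow> 'o \<Rightarrow> 'm"
  VIde :: "'o \<Rightarrow> 'm"

locale V_category =
  monoidal_category V for V :: "('v, 'm, 'x) monoidal_data_scheme" (structure) +
  fixes B :: "('o, 'v, 'm) Vcategory_data"
  assumes VHom_Obj: "\<lbrakk>a \<in> VObj B; b \<in> VObj B\<rbrakk> \<Longrightarrow> VHom B a b \<in> Obj V"
    and VComp_hom: "\<lbrakk>a \<in> VObj B; b \<in> VObj B; c \<in> VObj B\<rbrakk>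
      \<Longrightarrow> VComp B a b c \<in> hom V (VHom B b c \<otimes> VHom B a b) (VHom B a c)"
    and VIde_hom: "a \<in> VObj B \<Longrightarrow> VIde B a \<in> hom V \<I> (VHom B a a)"
    and VComp_assoc: "\<lbrakk>a \<in> VObj B; b \<in> VObj B; c \<in> VObj B; d \<in> VObj B\<rbrakk>
      \<Longrightarrow> VComp B a b d \<cdot> (VComp B b c d \<boxtimes> \<i> (VHom B a b))
          = VComp B a c d \<cdot> (\<i> (VHom B c d) \<boxtimes> VComp B a b c)
              \<cdot> \<a> (VHom B c d) (VHom B b c) (VHom B a b)"
    and VIde_VComp: "\<lbrakk>a \<in> VObj B; b \<in> VObj B\<rbrakk>
      \<Longrightarrow> VComp B a b b \<cdot> (VIde B b \<boxtimes> \<i> (VHom B a b)) = \<l> (VHom B a b)"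
    and VComp_VIde: "\<lbrakk>a \<in> VObj B; b \<in> VObj B\<rbrakk>
      \<Longrightarrow> VComp B a a b \<cdot> (\<i> (VHom B a b) \<boxtimes> VIde B a) = \<r> (VHom B a b)"

text \<open>
  An arrow \<open>a \<rightarrow> b\<close> of the underlying category is an arrow \<open>I \<rightarrow> B(a, b)\<close> of the base,
  tagged with \<open>a\<close> and \<open>b\<close> so that it has a well-defined domain and codomain.
\<close>

definition underlying_category ::
  "('v, 'm, 'x) monoidal_data_scheme \<Rightarrow> ('o, 'v, 'm) Vcategory_data
    \<Rightarrow> ('o, 'o \<times> 'o \<times> 'm) category_data" where
  "underlying_category V B =
    \<lparr>Obj = VObj B,
     Arr = {(a, b, f). a \<in> VObj B \<and> b \<in> VObj B \<and> f \<in> hom V \<I>\<^bsub>V\<^esub> (VHom B a b)},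
     Dom = (\<lambda>(a, b, f). a),
     Cod = (\<lambda>(a, b, f). b),
     Ide = (\<lambda>a. (a, a, VIde B a)),
     Comp = (\<lambda>(b', c, g) (a, b, f).
       (a, c, VComp B a b c \<cdot>\<^bsub>V\<^esub> (g \<boxtimes>\<^bsub>V\<^esub> f) \<cdot>\<^bsub>V\<^esub> inv_arr V (\<l>\<^bsub>V\<^esub> \<I>\<^bsub>V\<^esub>)))\<rparr>"

record ('o, 'p, 'm) Vfunctor_data =
  VonObj :: "'o \<Rightarrow> 'p"
  VonHom :: "'o \<Rightarrow> 'o \<Rightarrow> 'm"

text \<open>
  The next two predicates state the axioms on \<open>F\<close> and \<open>\<tau>\<close> only; they are applied to data
  \<open>B\<close>, \<open>C\<close> that are \<open>V\<close>-categories (and, for \<open>V_nat_iso\<close>, to \<open>V\<close>-functors \<open>F\<close>, \<open>G\<close>).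
\<close>

definition V_functor ::
  "('v, 'm, 'x) monoidal_data_scheme \<Rightarrow> ('o, 'v, 'm) Vcategory_data
    \<Rightarrow> ('p, 'v, 'm) Vcategory_data \<Rightarrow> ('o, 'p, 'm) Vfunctor_data \<Rightarrow> bool" where
  "V_functor V B C F \<longleftrightarrow>
    (\<forall>a \<in> VObj B. VonObj F a \<in> VObj C) \<and>
    (\<forall>a \<in> VObj B. \<forall>b \<in> VObj B.
       VonHom F a b \<in> hom V (VHom B a b) (VHom C (VonObj F a) (VonObj F b))) \<and>
    (\<forall>a \<in> VObj B. \<forall>b \<in> VObj B. \<forall>c \<in> VObj B.
       VonHom F a c \<cdot>\<^bsub>V\<^esub> VComp B a b c
       = VComp C (VonObj F a) (VonObj F b) (VonObj F c)
         \<cdot>\<^bsub>V\<^esub> (VonHom F b c \<boxtimes>\<^bsub>V\<^esub> VonHom F a b)) \<and>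
    (\<forall>a \<in> VObj B. VonHom F a a \<cdot>\<^bsub>V\<^esub> VIde B a = VIde C (VonObj F a))"

definition V_nat_iso ::
  "('v, 'm, 'x) monoidal_data_scheme \<Rightarrow> ('o, 'v, 'm) Vcategory_data
    \<Rightarrow> ('p, 'v, 'm) Vcategory_data \<Rightarrow> ('o, 'p, 'm) Vfunctor_data
    \<Rightarrow> ('o, 'p, 'm) Vfunctor_data \<Rightarrow> ('o \<Rightarrow> 'm) \<Rightarrow> bool" where
  "V_nat_iso V B C F G \<tau> \<longleftrightarrow>
    (\<forall>a \<in> VObj B. \<tau> a \<in> hom V \<I>\<^bsub>V\<^esub> (VHom C (VonObj F a) (VonObj G a))) \<and>
    (\<forall>a \<in> VObj B. \<forall>b \<in> VObj B.
       VComp C (VonObj F a) (VonObj F b) (VonObj G b)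
         \<cdot>\<^bsub>V\<^esub> (\<tau> b \<boxtimes>\<^bsub>V\<^esub> VonHom F a b) \<cdot>\<^bsub>V\<^esub> inv_arr V (\<l>\<^bsub>V\<^esub> (VHom B a b))
       = VComp C (VonObj F a) (VonObj G a) (VonObj G b)
         \<cdot>\<^bsub>V\<^esub> (VonHom G a b \<boxtimes>\<^bsub>V\<^esub> \<tau> a) \<cdot>\<^bsub>V\<^esub> inv_arr V (\<r>\<^bsub>V\<^esub> (VHom B a b))) \<and>
    (\<forall>a \<in> VObj B. iso (underlying_category V C) (VonObj F a, VonObj G a, \<tau> a))"

definition Vid :: "('v, 'm, 'x) monoidal_data_scheme \<Rightarrow> ('o, 'v, 'm) Vcategory_data
    \<Rightarrow> ('o, 'o, 'm) Vfunctor_data" where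
  "Vid V B = \<lparr>VonObj = (\<lambda>a. a), VonHom = (\<lambda>a b. \<i>\<^bsub>V\<^esub> (VHom B a b))\<rparr>"

definition Vcompose :: "('v, 'm, 'x) monoidal_data_scheme \<Rightarrow> ('p, 'q, 'm) Vfunctor_data
    \<Rightarrow> ('o, 'p, 'm) Vfunctor_data \<Rightarrow> ('o, 'q, 'm) Vfunctor_data" where
  "Vcompose V G F =
    \<lparr>VonObj = (\<lambda>a. VonObj G (VonObj F a)),
     VonHom = (\<lambda>a b. VonHom G (VonObj F a) (VonObj F b) \<cdot>\<^bsub>V\<^esub> VonHom F a b)\<rparr>"

definition Vtensor_category :: "('v, 'm, 'x) braided_data_scheme \<Rightarrow> ('o, 'v, 'm) Vcategory_data
    \<Rightarrow> ('p, 'v, 'm) Vcategory_data \<Rightarrow> ('o \<times> 'p, 'v, 'm) Vcategory_data" where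
  "Vtensor_category V B C =
    \<lparr>VObj = VObj B \<times> VObj C,
     VHom = (\<lambda>(a, a') (b, b'). VHom B a b \<otimes>\<^bsub>V\<^esub> VHom C a' b'),
     VComp = (\<lambda>(a, a') (b, b') (c, c').
       (VComp B a b c \<boxtimes>\<^bsub>V\<^esub> VComp C a' b' c')
       \<cdot>\<^bsub>V\<^esub> interchange V (VHom B b c) (VHom C b' c') (VHom B a b) (VHom C a' b')),
     VIde = (\<lambda>(a, a'). (VIde B a \<boxtimes>\<^bsub>V\<^esub> VIde C a') \<cdot>\<^bsub>V\<^esub> inv_arr V (\<l>\<^bsub>V\<^esub> \<I>\<^bsub>V\<^esub>))\<rparr>"

definition Vtensor_functor :: "('v, 'm, 'x) monoidal_data_scheme \<Rightarrow> ('o, 'p, 'm) Vfunctor_data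
    \<Rightarrow> ('q, 'r, 'm) Vfunctor_data \<Rightarrow> ('o \<times> 'q, 'p \<times> 'r, 'm) Vfunctor_data" where
  "Vtensor_functor V F G =
    \<lparr>VonObj = (\<lambda>(a, a'). (VonObj F a, VonObj G a')),
     VonHom = (\<lambda>(a, a') (b, b'). VonHom F a b \<boxtimes>\<^bsub>V\<^esub> VonHom G a' b')\<rparr>"

text \<open>The canonical \<open>V\<close>-functor \<open>(B \<otimes> C) \<otimes> D \<rightarrow> B \<otimes> (C \<otimes> D)\<close>.\<close>

definition Vassociator :: "('v, 'm, 'x) monoidal_data_scheme \<Rightarrow> ('o, 'v, 'm) Vcategory_data
    \<Rightarrow> ('p, 'v, 'm) Vcategory_data \<Rightarrow> ('q, 'v, 'm) Vcategory_data
    \<Rightarrow> (('o \<times> 'p) \<times> 'q, 'o \<times> 'p \<times> 'q, 'm) Vfunctor_data" where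
  "Vassociator V B C D =
    \<lparr>VonObj = (\<lambda>((a, b), c). (a, (b, c))),
     VonHom = (\<lambda>((a, b), c) ((a', b'), c'). \<a>\<^bsub>V\<^esub> (VHom B a a') (VHom C b b') (VHom D c c'))\<rparr>"

text \<open>The \<open>V\<close>-functors \<open>T(u, -)\<close> and \<open>T(-, u)\<close> for \<open>T : B \<otimes> B \<rightarrow> B\<close>.\<close>

definition Vsection_left :: "('v, 'm, 'x) monoidal_data_scheme \<Rightarrow> ('o, 'v, 'm) Vcategory_data
    \<Rightarrow> ('o \<times> 'o, 'o, 'm) Vfunctor_data \<Rightarrow> 'o \<Rightarrow> ('o, 'o, 'm) Vfunctor_data" where
  "Vsection_left V B T u =
    \<lparr>VonObj = (\<lambda>a. VonObj T (u, a)),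
     VonHom = (\<lambda>a b. VonHom T (u, a) (u, b)
       \<cdot>\<^bsub>V\<^esub> (VIde B u \<boxtimes>\<^bsub>V\<^esub> \<i>\<^bsub>V\<^esub> (VHom B a b)) \<cdot>\<^bsub>V\<^esub> inv_arr V (\<l>\<^bsub>V\<^esub> (VHom B a b)))\<rparr>"

definition Vsection_right :: "('v, 'm, 'x) monoidal_data_scheme \<Rightarrow> ('o, 'v, 'm) Vcategory_data
    \<Rightarrow> ('o \<times> 'o, 'o, 'm) Vfunctor_data \<Rightarrow> 'o \<Rightarrow> ('o, 'o, 'm) Vfunctor_data" where
  "Vsection_right V B T u =
    \<lparr>VonObj = (\<lambda>a. VonObj T (a, u)),
     VonHom = (\<lambda>a b. VonHom T (a, u) (b, u)
       \<cdot>\<^bsub>V\<^esub> (\<i>\<^bsub>V\<^esub> (VHom B a b) \<boxtimes>\<^bsub>V\<^esub> VIde B u) \<cdot>\<^bsub>V\<^esub> inv_arr V (\<r>\<^bsub>V\<^esub> (VHom B a b)))\<rparr>"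

record ('o, 'm) Vmonoidal_data =
  VTens :: "('o \<times> 'o, 'o, 'm) Vfunctor_data"
  VUnit :: "'o"
  VAssoc :: "'o \<Rightarrow> 'o \<Rightarrow> 'o \<Rightarrow> 'm"
  VLUnit :: "'o \<Rightarrow> 'm"
  VRUnit :: "'o \<Rightarrow> 'm"

definition underlying_monoidal ::
  "('v, 'm, 'x) monoidal_data_scheme \<Rightarrow> ('o, 'v, 'm) Vcategory_data
    \<Rightarrow> ('o, 'm) Vmonoidal_data \<Rightarrow> ('o, 'o \<times> 'o \<times> 'm) monoidal_data" where
  "underlying_monoidal V B S =
    (let t = (\<lambda>a b. VonObj (VTens S) (a, b)); u = VUnit S in
     category_data.extend (underlying_category V B)
      (monoidal_data.fields
        t
        (\<lambda>(a, c, f) (b, d, g). (t a b, t c d,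
           VonHom (VTens S) (a, b) (c, d) \<cdot>\<^bsub>V\<^esub> (f \<boxtimes>\<^bsub>V\<^esub> g) \<cdot>\<^bsub>V\<^esub> inv_arr V (\<l>\<^bsub>V\<^esub> \<I>\<^bsub>V\<^esub>)))
        u
        (\<lambda>a b c. (t (t a b) c, t a (t b c), VAssoc S a b c))
        (\<lambda>a. (t u a, a, VLUnit S a))
        (\<lambda>a. (t a u, a, VRUnit S a))))"

locale monoidal_V_category =
  braided_monoidal_category V + V_category V B
  for V :: "('v, 'm, 'x) braided_data_scheme" (structure)
    and B :: "('o, 'v, 'm) Vcategory_data" +
  fixes S :: "('o, 'm) Vmonoidal_data"
  assumes VTens_functor: "V_functor V (Vtensor_category V B B) B (VTens S)"
    and VUnit_VObj: "VUnit S \<in> VObj B"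
    and VAssoc_nat_iso:
      "V_nat_iso V (Vtensor_category V (Vtensor_category V B B) B) B
         (Vcompose V (VTens S) (Vtensor_functor V (VTens S) (Vid V B)))
         (Vcompose V (VTens S)
           (Vcompose V (Vtensor_functor V (Vid V B) (VTens S)) (Vassociator V B B B)))
         (\<lambda>((a, b), c). VAssoc S a b c)"
    and VLUnit_nat_iso:
      "V_nat_iso V B B (Vsection_left V B (VTens S) (VUnit S)) (Vid V B) (VLUnit S)"
    and VRUnit_nat_iso:
      "V_nat_iso V B B (Vsection_right V B (VTens S) (VUnit S)) (Vid V B) (VRUnit S)"
    and underlying_monoidal_category: "monoidal_category (underlying_monoidal V B S)"


section \<open>Actions and the categories they enrich\<close>

record ('v, 'm, 'o, 'n) action_data =
  ActO :: "'v \<Rightarrow> 'o \<Rightarrow> 'o" (infixr "\<star>\<index>" 74)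
  ActA :: "'m \<Rightarrow> 'n \<Rightarrow> 'n" (infixr "\<odot>\<index>" 74)
  ActAssoc :: "'v \<Rightarrow> 'v \<Rightarrow> 'o \<Rightarrow> 'n" ("\<alpha>\<index>")
  ActUnit :: "'o \<Rightarrow> 'n" ("\<lambda>\<lambda>\<index>")

locale left_action =
  base: monoidal_category V + acted: category A
  for V :: "('v, 'm, 'x) monoidal_data_scheme"
    and A :: "('o, 'n, 'y) category_data_scheme"
    and act :: "('v, 'm, 'o, 'n) action_data" (structure) +
  assumes action_functor:
      "cat_functor (product_category V A) A (bifunctor_data (\<star>) (\<odot>))"
    and ActAssoc_hom: "\<lbrakk>X \<in> Obj V; Y \<in> Obj V; a \<in> Obj A\<rbrakk>
      \<Longrightarrow> \<alpha> X Y a \<in> hom A (X \<star> (Y \<star> a)) ((X \<otimes>\<^bsub>V\<^esub> Y) \<star> a)"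
    and ActAssoc_iso: "\<lbrakk>X \<in> Obj V; Y \<in> Obj V; a \<in> Obj A\<rbrakk> \<Longrightarrow> iso A (\<alpha> X Y a)"
    and ActAssoc_natural: "\<lbrakk>f \<in> hom V X X'; g \<in> hom V Y Y'; h \<in> hom A a a'\<rbrakk>
      \<Longrightarrow> \<alpha> X' Y' a' \<cdot>\<^bsub>A\<^esub> (f \<odot> (g \<odot> h)) = ((f \<boxtimes>\<^bsub>V\<^esub> g) \<odot> h) \<cdot>\<^bsub>A\<^esub> \<alpha> X Y a"
    and ActUnit_hom: "a \<in> Obj A \<Longrightarrow> \<lambda>\<lambda> a \<in> hom A (\<I>\<^bsub>V\<^esub> \<star> a) a"
    and ActUnit_iso: "a \<in> Obj A \<Longrightarrow> iso A (\<lambda>\<lambda> a)"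
    and ActUnit_natural: "h \<in> hom A a a'
      \<Longrightarrow> \<lambda>\<lambda> a' \<cdot>\<^bsub>A\<^esub> (\<i>\<^bsub>V\<^esub> \<I>\<^bsub>V\<^esub> \<odot> h) = h \<cdot>\<^bsub>A\<^esub> \<lambda>\<lambda> a"
    and action_pentagon: "\<lbrakk>X \<in> Obj V; Y \<in> Obj V; Z \<in> Obj V; a \<in> Obj A\<rbrakk>
      \<Longrightarrow> (\<a>\<^bsub>V\<^esub> X Y Z \<odot> \<i>\<^bsub>A\<^esub> a) \<cdot>\<^bsub>A\<^esub> \<alpha> (X \<otimes>\<^bsub>V\<^esub> Y) Z a \<cdot>\<^bsub>A\<^esub> \<alpha> X Y (Z \<star> a)
          = \<alpha> X (Y \<otimes>\<^bsub>V\<^esub> Z) a \<cdot>\<^bsub>A\<^esub> (\<i>\<^bsub>V\<^esub> X \<odot> \<alpha> Y Z a)"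
    and action_triangle_left: "\<lbrakk>X \<in> Obj V; a \<in> Obj A\<rbrakk>
      \<Longrightarrow> (\<l>\<^bsub>V\<^esub> X \<odot> \<i>\<^bsub>A\<^esub> a) \<cdot>\<^bsub>A\<^esub> \<alpha> \<I>\<^bsub>V\<^esub> X a = \<lambda>\<lambda> (X \<star> a)"
    and action_triangle_right: "\<lbrakk>X \<in> Obj V; a \<in> Obj A\<rbrakk>
      \<Longrightarrow> (\<r>\<^bsub>V\<^esub> X \<odot> \<i>\<^bsub>A\<^esub> a) \<cdot>\<^bsub>A\<^esub> \<alpha> X \<I>\<^bsub>V\<^esub> a = \<i>\<^bsub>V\<^esub> X \<odot> \<lambda>\<lambda> a"

text \<open>The functor \<open>- \<star> a\<close>.\<close>

definition act_on ::
  "('o, 'n, 'y) category_data_scheme \<Rightarrow> ('v, 'm, 'o, 'n) action_data \<Rightarrow> 'o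
    \<Rightarrow> ('v, 'm, 'o, 'n) functor_data" where
  "act_on A act a =
     \<lparr>onObj = (\<lambda>X. X \<star>\<^bsub>act\<^esub> a), onArr = (\<lambda>f. f \<odot>\<^bsub>act\<^esub> \<i>\<^bsub>A\<^esub> a)\<rparr>"

text \<open>
  For a family \<open>R\<close> with \<open>R a\<close> right adjoint to \<open>- \<star> a\<close>, the hom-object from \<open>a\<close> to \<open>b\<close> is the
  value of \<open>R a\<close> at \<open>b\<close>.
\<close>

definition enriched_category ::
  "('v, 'm, 'x) monoidal_data_scheme \<Rightarrow> ('o, 'n, 'y) category_data_scheme
    \<Rightarrow> ('v, 'm, 'o, 'n) action_data \<Rightarrow> ('o \<Rightarrow> ('v, 'm, 'o, 'n) right_adjoint_data)
    \<Rightarrow> ('o, 'v, 'm) Vcategory_data" where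
  "enriched_category V A act R =
    (let H = (\<lambda>a b. onObj (RightAdj (R a)) b); \<epsilon> = (\<lambda>a b. Counit (R a) b) in
     \<lparr>VObj = Obj A,
      VHom = H,
      VComp = (\<lambda>a b c. transpose V (R a) (H b c \<otimes>\<^bsub>V\<^esub> H a b)
        (\<epsilon> b c \<cdot>\<^bsub>A\<^esub> (\<i>\<^bsub>V\<^esub> (H b c) \<odot>\<^bsub>act\<^esub> \<epsilon> a b)
          \<cdot>\<^bsub>A\<^esub> inv_arr A (\<alpha>\<^bsub>act\<^esub> (H b c) (H a b) a))),
      VIde = (\<lambda>a. transpose V (R a) \<I>\<^bsub>V\<^esub> (\<lambda>\<lambda>\<^bsub>act\<^esub> a))\<rparr>)"

text \<open>
  The bijection from arrows \<open>f : a \<rightarrow> b\<close> to arrows \<open>I \<rightarrow> R a b\<close>, sending \<open>f\<close> to the transpose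
  of \<open>f \<cdot> \<lambda>\<lambda> a : I \<star> a \<rightarrow> b\<close>.
\<close>

definition arrow_name ::
  "('v, 'm, 'x) monoidal_data_scheme \<Rightarrow> ('o, 'n, 'y) category_data_scheme
    \<Rightarrow> ('v, 'm, 'o, 'n) action_data \<Rightarrow> ('o \<Rightarrow> ('v, 'm, 'o, 'n) right_adjoint_data)
    \<Rightarrow> 'n \<Rightarrow> 'm" where
  "arrow_name V A act R f =
     transpose V (R (Dom A f)) \<I>\<^bsub>V\<^esub> (f \<cdot>\<^bsub>A\<^esub> \<lambda>\<lambda>\<^bsub>act\<^esub> (Dom A f))"

definition underlying_comparison ::
  "('v, 'm, 'x) monoidal_data_scheme \<Rightarrow> ('o, 'n, 'y) category_data_scheme
    \<Rightarrow> ('v, 'm, 'o, 'n) action_data \<Rightarrow> ('o \<Rightarrow> ('v, 'm, 'o, 'n) right_adjoint_data)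
    \<Rightarrow> ('o, 'n, 'o, 'o \<times> 'o \<times> 'm) functor_data" where
  "underlying_comparison V A act R =
     \<lparr>onObj = (\<lambda>a. a), onArr = (\<lambda>f. (Dom A f, Cod A f, arrow_name V A act R f))\<rparr>"


section \<open>Opmonoidal actions\<close>

record ('v, 'o, 'n) opmonoidal_data =
  Xi :: "'v \<Rightarrow> 'v \<Rightarrow> 'o \<Rightarrow> 'o \<Rightarrow> 'n" ("\<xi>\<index>")
  Xi0 :: "'n" ("\<xi>0\<index>")

text \<open>
  The axioms up to \<open>Xi_right_unit\<close> say that \<open>\<star>\<close> is an opmonoidal functor on the product monoidal
  category \<open>V \<times> A\<close>; the remaining ones say that \<open>\<alpha>\<close> and \<open>\<lambda>\<lambda>\<close> are opmonoidal transformations.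
\<close>

locale opmonoidal_action =
  base: braided_monoidal_category V + acted: monoidal_category A + left_action V A act
  for V :: "('v, 'm, 'x) braided_data_scheme"
    and A :: "('o, 'n, 'y) monoidal_data_scheme"
    and act :: "('v, 'm, 'o, 'n) action_data" (structure)
    and op :: "('v, 'o, 'n) opmonoidal_data" (structure) +
  assumes Xi0_hom: "\<xi>0\<^bsub>op\<^esub> \<in> hom A (\<I>\<^bsub>V\<^esub> \<star> \<I>\<^bsub>A\<^esub>) \<I>\<^bsub>A\<^esub>"
    and Xi_hom: "\<lbrakk>X \<in> Obj V; Y \<in> Obj V; a \<in> Obj A; b \<in> Obj A\<rbrakk>
      \<Longrightarrow> \<xi>\<^bsub>op\<^esub> X Y a b \<in> hom A ((X \<otimes>\<^bsub>V\<^esub> Y) \<star> (a \<otimes>\<^bsub>A\<^esub> b)) ((X \<star> a) \<otimes>\<^bsub>A\<^esub> (Y \<star> b))"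
    and Xi_natural: "\<lbrakk>f \<in> hom V X X'; g \<in> hom V Y Y'; h \<in> hom A a a'; k \<in> hom A b b'\<rbrakk>
      \<Longrightarrow> \<xi>\<^bsub>op\<^esub> X' Y' a' b' \<cdot>\<^bsub>A\<^esub> ((f \<boxtimes>\<^bsub>V\<^esub> g) \<odot> (h \<boxtimes>\<^bsub>A\<^esub> k))
          = ((f \<odot> h) \<boxtimes>\<^bsub>A\<^esub> (g \<odot> k)) \<cdot>\<^bsub>A\<^esub> \<xi>\<^bsub>op\<^esub> X Y a b"
    and Xi_assoc: "\<lbrakk>X \<in> Obj V; Y \<in> Obj V; Z \<in> Obj V; a \<in> Obj A; b \<in> Obj A; c \<in> Obj A\<rbrakk>
      \<Longrightarrow> \<a>\<^bsub>A\<^esub> (X \<star> a) (Y \<star> b) (Z \<star> c)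
            \<cdot>\<^bsub>A\<^esub> (\<xi>\<^bsub>op\<^esub> X Y a b \<boxtimes>\<^bsub>A\<^esub> \<i>\<^bsub>A\<^esub> (Z \<star> c))
            \<cdot>\<^bsub>A\<^esub> \<xi>\<^bsub>op\<^esub> (X \<otimes>\<^bsub>V\<^esub> Y) Z (a \<otimes>\<^bsub>A\<^esub> b) c
          = (\<i>\<^bsub>A\<^esub> (X \<star> a) \<boxtimes>\<^bsub>A\<^esub> \<xi>\<^bsub>op\<^esub> Y Z b c)
            \<cdot>\<^bsub>A\<^esub> \<xi>\<^bsub>op\<^esub> X (Y \<otimes>\<^bsub>V\<^esub> Z) a (b \<otimes>\<^bsub>A\<^esub> c)
            \<cdot>\<^bsub>A\<^esub> (\<a>\<^bsub>V\<^esub> X Y Z \<odot> \<a>\<^bsub>A\<^esub> a b c)"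
    and Xi_left_unit: "\<lbrakk>X \<in> Obj V; a \<in> Obj A\<rbrakk>
      \<Longrightarrow> \<l>\<^bsub>A\<^esub> (X \<star> a) \<cdot>\<^bsub>A\<^esub> (\<xi>0\<^bsub>op\<^esub> \<boxtimes>\<^bsub>A\<^esub> \<i>\<^bsub>A\<^esub> (X \<star> a)) \<cdot>\<^bsub>A\<^esub> \<xi>\<^bsub>op\<^esub> \<I>\<^bsub>V\<^esub> X \<I>\<^bsub>A\<^esub> a
          = \<l>\<^bsub>V\<^esub> X \<odot> \<l>\<^bsub>A\<^esub> a"
    and Xi_right_unit: "\<lbrakk>X \<in> Obj V; a \<in> Obj A\<rbrakk>
      \<Longrightarrow> \<r>\<^bsub>A\<^esub> (X \<star> a) \<cdot>\<^bsub>A\<^esub> (\<i>\<^bsub>A\<^esub> (X \<star> a) \<boxtimes>\<^bsub>A\<^esub> \<xi>0\<^bsub>op\<^esub>) \<cdot>\<^bsub>A\<^esub> \<xi>\<^bsub>op\<^esub> X \<I>\<^bsub>V\<^esub> a \<I>\<^bsub>A\<^esub>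
          = \<r>\<^bsub>V\<^esub> X \<odot> \<r>\<^bsub>A\<^esub> a"
    and ActAssoc_opmonoidal:
      "\<lbrakk>X \<in> Obj V; X' \<in> Obj V; Y \<in> Obj V; Y' \<in> Obj V; a \<in> Obj A; a' \<in> Obj A\<rbrakk>
      \<Longrightarrow> (\<alpha> X Y a \<boxtimes>\<^bsub>A\<^esub> \<alpha> X' Y' a')
            \<cdot>\<^bsub>A\<^esub> \<xi>\<^bsub>op\<^esub> X X' (Y \<star> a) (Y' \<star> a')
            \<cdot>\<^bsub>A\<^esub> (\<i>\<^bsub>V\<^esub> (X \<otimes>\<^bsub>V\<^esub> X') \<odot> \<xi>\<^bsub>op\<^esub> Y Y' a a')
          = \<xi>\<^bsub>op\<^esub> (X \<otimes>\<^bsub>V\<^esub> Y) (X' \<otimes>\<^bsub>V\<^esub> Y') a a'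
            \<cdot>\<^bsub>A\<^esub> (interchange V X X' Y Y' \<odot> \<i>\<^bsub>A\<^esub> (a \<otimes>\<^bsub>A\<^esub> a'))
            \<cdot>\<^bsub>A\<^esub> \<alpha> (X \<otimes>\<^bsub>V\<^esub> X') (Y \<otimes>\<^bsub>V\<^esub> Y') (a \<otimes>\<^bsub>A\<^esub> a')"
    and ActAssoc_opmonoidal_unit:
      "\<xi>0\<^bsub>op\<^esub> \<cdot>\<^bsub>A\<^esub> (\<i>\<^bsub>V\<^esub> \<I>\<^bsub>V\<^esub> \<odot> \<xi>0\<^bsub>op\<^esub>)
       = \<xi>0\<^bsub>op\<^esub> \<cdot>\<^bsub>A\<^esub> (\<l>\<^bsub>V\<^esub> \<I>\<^bsub>V\<^esub> \<odot> \<i>\<^bsub>A\<^esub> \<I>\<^bsub>A\<^esub>) \<cdot>\<^bsub>A\<^esub> \<alpha> \<I>\<^bsub>V\<^esub> \<I>\<^bsub>V\<^esub> \<I>\<^bsub>A\<^esub>"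
    and ActUnit_opmonoidal: "\<lbrakk>a \<in> Obj A; b \<in> Obj A\<rbrakk>
      \<Longrightarrow> (\<lambda>\<lambda> a \<boxtimes>\<^bsub>A\<^esub> \<lambda>\<lambda> b) \<cdot>\<^bsub>A\<^esub> \<xi>\<^bsub>op\<^esub> \<I>\<^bsub>V\<^esub> \<I>\<^bsub>V\<^esub> a b
          = \<lambda>\<lambda> (a \<otimes>\<^bsub>A\<^esub> b) \<cdot>\<^bsub>A\<^esub> (\<l>\<^bsub>V\<^esub> \<I>\<^bsub>V\<^esub> \<odot> \<i>\<^bsub>A\<^esub> (a \<otimes>\<^bsub>A\<^esub> b))"
    and ActUnit_opmonoidal_unit: "\<xi>0\<^bsub>op\<^esub> = \<lambda>\<lambda> \<I>\<^bsub>A\<^esub>"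

definition induced_monoidal ::
  "('v, 'm, 'x) monoidal_data_scheme \<Rightarrow> ('o, 'n, 'y) monoidal_data_scheme
    \<Rightarrow> ('v, 'm, 'o, 'n) action_data \<Rightarrow> ('o \<Rightarrow> ('v, 'm, 'o, 'n) right_adjoint_data)
    \<Rightarrow> ('v, 'o, 'n) opmonoidal_data \<Rightarrow> ('o, 'm) Vmonoidal_data" where
  "induced_monoidal V A act R op =
    (let H = (\<lambda>a b. onObj (RightAdj (R a)) b); \<epsilon> = (\<lambda>a b. Counit (R a) b) in
     \<lparr>VTens =
        \<lparr>VonObj = (\<lambda>(a, b). a \<otimes>\<^bsub>A\<^esub> b),
         VonHom = (\<lambda>(a, b) (c, d). transpose V (R (a \<otimes>\<^bsub>A\<^esub> b)) (H a c \<otimes>\<^bsub>V\<^esub> H b d)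
           ((\<epsilon> a c \<boxtimes>\<^bsub>A\<^esub> \<epsilon> b d) \<cdot>\<^bsub>A\<^esub> \<xi>\<^bsub>op\<^esub> (H a c) (H b d) a b))\<rparr>,
      VUnit = \<I>\<^bsub>A\<^esub>,
      VAssoc = (\<lambda>a b c. arrow_name V A act R (\<a>\<^bsub>A\<^esub> a b c)),
      VLUnit = (\<lambda>a. arrow_name V A act R (\<l>\<^bsub>A\<^esub> a)),
      VRUnit = (\<lambda>a. arrow_name V A act R (\<r>\<^bsub>A\<^esub> a))\<rparr>)"

end

theory Submission
  imports Defs
begin

text \<open>
  An arrow into a hom-object \<open>H a b\<close> is determined by its transpose, so every axiom of the enriched
  structure may be checked in \<open>A\<close>. After transposition, composition with an arrow \<open>g \<otimes> f\<close> becomes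
  \<open>g\<^sup>\<flat> \<cdot> (1 \<star> f\<^sup>\<flat>) \<cdot> \<alpha>\<inverse>\<close> and the tensor \<open>V\<close>-functor applied to \<open>f \<otimes> g\<close> becomes
  \<open>(f\<^sup>\<flat> \<diamond> g\<^sup>\<flat>) \<cdot> \<xi>\<close>. Functoriality of the tensor on composites and identities is then the opmonoidality of
  \<open>\<alpha>\<close> and \<open>\<lambda>\<close>, and \<open>V\<close>-naturality of the constraints is the associativity and unit axioms for
  \<open>\<xi>\<close>, using \<open>\<xi>0 = \<lambda>\<lambda> J\<close>. The underlying monoidal category is a copy of \<open>A\<close> along the bijection
  \<open>A(a, b) \<cong> V(I, H a b)\<close>.
\<close>

section \<open>Categories\<close>

text \<open>The action constraint \<open>\<alpha>\<close> points towards
  \<open>(X \<otimes> Y) \<star> a\<close>, while enriched composition contains its inverse. The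
  action axioms are therefore restated for inverses (naturality, pentagon, triangles), or
  \<open>\<alpha>\<close> is precomposed and cancelled as an epimorphism. The braiding enters only
  through \<open>interchange\<close>: composition in the tensor square of the enriched category and
  the opmonoidality of \<open>\<alpha>\<close> contain the same such arrow. Typing is left to
  rewriting: membership in \<open>hom\<close> is unfolded into equations for \<open>Dom\<close> and
  \<open>Cod\<close>, and composites are normalised to right-nested form. An axiom that rewrites two
  neighbouring factors must therefore be exposed by hand, which is why several calculation steps
  only move brackets. Invertibility of a \<open>V\<close>-natural constraint is a statement about
  the underlying category, so the comparison with \<open>A\<close> has to be in place before the
  constraints can be shown to be \<open>V\<close>-natural isomorphisms.\<close>

lemma hom_iff: "f \<in> hom C a b \<longleftrightarrow> f \<in> Arr C \<and> Dom C f = a \<and> Cod C f = b"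
  by (simp add: hom_def)

context category
begin

lemma Arr_Ide [simp]: "a \<in> Obj C \<Longrightarrow> \<i> a \<in> Arr C"
  and Dom_Ide [simp]: "a \<in> Obj C \<Longrightarrow> Dom C (\<i> a) = a"
  and Cod_Ide [simp]: "a \<in> Obj C \<Longrightarrow> Cod C (\<i> a) = a"
  using Ide_hom by (auto simp: hom_iff)

lemma Arr_Comp [simp]: "\<lbrakk>f \<in> Arr C; g \<in> Arr C; Cod C f = Dom C g\<rbrakk> \<Longrightarrow> g \<cdot> f \<in> Arr C"
  and Dom_Comp [simp]: "\<lbrakk>f \<in> Arr C; g \<in> Arr C; Cod C f = Dom C g\<rbrakk> \<Longrightarrow> Dom C (g \<cdot> f) = Dom C f"
  and Cod_Comp [simp]: "\<lbrakk>f \<in> Arr C; g \<in> Arr C; Cod C f = Dom C g\<rbrakk> \<Longrightarrow> Cod C (g \<cdot> f) = Cod C g"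
  using Comp_hom[of f "Dom C f" "Cod C f" g "Cod C g"] by (auto simp: hom_iff)

lemma Comp_Ide_Dom [simp]: "\<lbrakk>f \<in> Arr C; Dom C f = a\<rbrakk> \<Longrightarrow> f \<cdot> \<i> a = f"
  and Ide_Comp_Cod [simp]: "\<lbrakk>f \<in> Arr C; Cod C f = b\<rbrakk> \<Longrightarrow> \<i> b \<cdot> f = f"
  by (auto intro: Comp_Ide Ide_Comp simp: hom_iff)

text \<open>As a rewrite rule this fixes the right-nested normal form; the typing side conditions
  are discharged by the \<open>Dom\<close> and \<open>Cod\<close> rules.\<close>

lemma Comp_assoc_Arr [simp]:
  "\<lbrakk>f \<in> Arr C; g \<in> Arr C; h \<in> Arr C; Cod C f = Dom C g; Cod C g = Dom C h\<rbrakk>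
    \<Longrightarrow> (h \<cdot> g) \<cdot> f = h \<cdot> (g \<cdot> f)"
  by (rule Comp_assoc) (auto simp: hom_iff)

lemma Dom_Cod_Obj [simp]:
  "f \<in> Arr C \<Longrightarrow> Dom C f \<in> Obj C" "f \<in> Arr C \<Longrightarrow> Cod C f \<in> Obj C"
  by (simp_all add: Dom_Obj Cod_Obj)

text \<open>Justifies the definite description in \<open>inv_arr\<close>.\<close>

lemma inverse_arrows_unique:
  assumes "inverse_arrows C f g" "inverse_arrows C f h"
  shows "g = h"
proof -
  have "g = g \<cdot> (f \<cdot> h)"
    using assms by (simp add: inverse_arrows_def hom_iff)
  also have "\<dots> = (g \<cdot> f) \<cdot> h"
    using assms by (subst Comp_assoc_Arr) (simp_all add: inverse_arrows_def hom_iff)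
  also have "\<dots> = h"
    using assms by (simp add: inverse_arrows_def hom_iff)
  finally show ?thesis .
qed

lemma inverse_arrows_inv_arr: "iso C f \<Longrightarrow> inverse_arrows C f (inv_arr C f)"
  unfolding iso_def inv_arr_def by (metis inverse_arrows_unique theI)

lemma iso_Arr: "iso C f \<Longrightarrow> f \<in> Arr C"
  by (auto simp: iso_def inverse_arrows_def)

lemma Arr_inv_arr [simp]: "iso C f \<Longrightarrow> inv_arr C f \<in> Arr C"
  and Dom_inv_arr [simp]: "iso C f \<Longrightarrow> Dom C (inv_arr C f) = Cod C f"
  and Cod_inv_arr [simp]: "iso C f \<Longrightarrow> Cod C (inv_arr C f) = Dom C f"
  and inv_arr_Comp [simp]: "iso C f \<Longrightarrow> inv_arr C f \<cdot> f = \<i> (Dom C f)"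
  and Comp_inv_arr [simp]: "iso C f \<Longrightarrow> f \<cdot> inv_arr C f = \<i> (Cod C f)"
  using inverse_arrows_inv_arr[of f] by (simp_all add: inverse_arrows_def hom_iff)

text \<open>Used to verify an equation involving inverses after precomposing an isomorphism that
  cancels them.\<close>

lemma iso_epi:
  assumes e: "iso C e" and f: "f \<in> Arr C" "Dom C f = Cod C e"
    and g: "g \<in> Arr C" "Dom C g = Cod C e" and eq: "f \<cdot> e = g \<cdot> e"
  shows "f = g"
proof -
  have "(f \<cdot> e) \<cdot> inv_arr C e = (g \<cdot> e) \<cdot> inv_arr C e"
    using eq by simp
  then show ?thesis
    using e f g iso_Arr[OF e] by simp
qed

lemma iso_mono:
  assumes e: "iso C e" and f: "f \<in> Arr C" "Cod C f = Dom C e"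
    and g: "g \<in> Arr C" "Cod C g = Dom C e" and eq: "e \<cdot> f = e \<cdot> g"
  shows "f = g"
proof -
  have "(inv_arr C e \<cdot> e) \<cdot> f = (inv_arr C e \<cdot> e) \<cdot> g"
    \<comment> \<open>With \<open>inv_arr_Comp\<close> disabled, reassociation exposes
      \<open>e \<cdot> f\<close>, where \<open>eq\<close> applies; otherwise the inverse pair would
      cancel first.\<close>
    using e f g iso_Arr[OF e] eq by (simp del: inv_arr_Comp)
  then show ?thesis
    using e f g by simp
qed

end

text \<open>Componentwise form of functoriality out of a product category, shared by the tensor
  product and by the action.\<close>

lemma bifunctor_functorial:
  assumes "cat_functor (product_category C D) E (bifunctor_data tO tA)"
  shows bifunctor_Obj: "\<lbrakk>a \<in> Obj C; b \<in> Obj D\<rbrakk> \<Longrightarrow> tO a b \<in> Obj E"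
    and bifunctor_hom: "\<lbrakk>f \<in> Arr C; g \<in> Arr D\<rbrakk>
      \<Longrightarrow> tA f g \<in> hom E (tO (Dom C f) (Dom D g)) (tO (Cod C f) (Cod D g))"
    and bifunctor_Ide: "\<lbrakk>a \<in> Obj C; b \<in> Obj D\<rbrakk> \<Longrightarrow> tA (Ide C a) (Ide D b) = Ide E (tO a b)"
    and bifunctor_Comp: "\<lbrakk>f \<in> Arr C; f' \<in> Arr C; Cod C f = Dom C f';
        g \<in> Arr D; g' \<in> Arr D; Cod D g = Dom D g'\<rbrakk>
      \<Longrightarrow> Comp E (tA f' g') (tA f g) = tA (Comp C f' f) (Comp D g' g)"
proof -
  interpret F: cat_functor "product_category C D" E "bifunctor_data tO tA"
    by fact
  note defs = product_category_def bifunctor_data_def hom_iff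
  show "tO a b \<in> Obj E" if "a \<in> Obj C" "b \<in> Obj D"
    using F.onObj[of "(a, b)"] that by (simp add: defs)
  show "tA f g \<in> hom E (tO (Dom C f) (Dom D g)) (tO (Cod C f) (Cod D g))"
    if "f \<in> Arr C" "g \<in> Arr D"
    using F.onArr[of "(f, g)" "(Dom C f, Dom D g)" "(Cod C f, Cod D g)"] that
    by (simp add: defs)
  show "tA (Ide C a) (Ide D b) = Ide E (tO a b)" if "a \<in> Obj C" "b \<in> Obj D"
    using F.onArr_Ide[of "(a, b)"] that by (simp add: defs)
  show "Comp E (tA f' g') (tA f g) = tA (Comp C f' f) (Comp D g' g)"
    if "f \<in> Arr C" "f' \<in> Arr C" "Cod C f = Dom C f'"
       "g \<in> Arr D" "g' \<in> Arr D" "Cod D g = Dom D g'"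
    using F.onArr_Comp[of "(f, g)" "(Dom C f, Dom D g)" "(Cod C f, Cod D g)"
        "(f', g')" "(Cod C f', Cod D g')"] that
    by (simp add: defs)
qed

context monoidal_category
begin

lemma TensO_Obj [simp]: "\<lbrakk>a \<in> Obj C; b \<in> Obj C\<rbrakk> \<Longrightarrow> a \<otimes> b \<in> Obj C"
  by (rule bifunctor_Obj[OF tensor_functor])

lemma Arr_TensA [simp]: "\<lbrakk>f \<in> Arr C; g \<in> Arr C\<rbrakk> \<Longrightarrow> f \<boxtimes> g \<in> Arr C"
  and Dom_TensA [simp]: "\<lbrakk>f \<in> Arr C; g \<in> Arr C\<rbrakk> \<Longrightarrow> Dom C (f \<boxtimes> g) = Dom C f \<otimes> Dom C g"
  and Cod_TensA [simp]: "\<lbrakk>f \<in> Arr C; g \<in> Arr C\<rbrakk> \<Longrightarrow> Cod C (f \<boxtimes> g) = Cod C f \<otimes> Cod C g"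
  using bifunctor_hom[OF tensor_functor, of f g] by (simp_all add: hom_iff)

lemma TensA_Ide [simp]: "\<lbrakk>a \<in> Obj C; b \<in> Obj C\<rbrakk> \<Longrightarrow> \<i> a \<boxtimes> \<i> b = \<i> (a \<otimes> b)"
  by (rule bifunctor_Ide[OF tensor_functor])

text \<open>The interchange law. It is not a default rewrite rule because it is used in both
  directions: to merge tensors of arrows and, flipped, to split them.\<close>

lemma TensA_Comp: "\<lbrakk>f \<in> Arr C; f' \<in> Arr C; Cod C f = Dom C f';
    g \<in> Arr C; g' \<in> Arr C; Cod C g = Dom C g'\<rbrakk>
  \<Longrightarrow> (f' \<boxtimes> g') \<cdot> (f \<boxtimes> g) = (f' \<cdot> f) \<boxtimes> (g' \<cdot> g)"
  by (rule bifunctor_Comp[OF tensor_functor])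

declare UnitO_Obj [simp] Assoc_iso [simp] LUnit_iso [simp] RUnit_iso [simp]

lemma Arr_Assoc [simp]: "\<lbrakk>a \<in> Obj C; b \<in> Obj C; c \<in> Obj C\<rbrakk> \<Longrightarrow> \<a> a b c \<in> Arr C"
  and Dom_Assoc [simp]:
    "\<lbrakk>a \<in> Obj C; b \<in> Obj C; c \<in> Obj C\<rbrakk> \<Longrightarrow> Dom C (\<a> a b c) = (a \<otimes> b) \<otimes> c"
  and Cod_Assoc [simp]:
    "\<lbrakk>a \<in> Obj C; b \<in> Obj C; c \<in> Obj C\<rbrakk> \<Longrightarrow> Cod C (\<a> a b c) = a \<otimes> b \<otimes> c"
  using Assoc_hom[of a b c] by (simp_all add: hom_iff)

lemma Arr_LUnit [simp]: "a \<in> Obj C \<Longrightarrow> \<l> a \<in> Arr C"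
  and Dom_LUnit [simp]: "a \<in> Obj C \<Longrightarrow> Dom C (\<l> a) = \<I> \<otimes> a"
  and Cod_LUnit [simp]: "a \<in> Obj C \<Longrightarrow> Cod C (\<l> a) = a"
  using LUnit_hom[of a] by (simp_all add: hom_iff)

lemma Arr_RUnit [simp]: "a \<in> Obj C \<Longrightarrow> \<r> a \<in> Arr C"
  and Dom_RUnit [simp]: "a \<in> Obj C \<Longrightarrow> Dom C (\<r> a) = a \<otimes> \<I>"
  and Cod_RUnit [simp]: "a \<in> Obj C \<Longrightarrow> Cod C (\<r> a) = a"
  using RUnit_hom[of a] by (simp_all add: hom_iff)

end

context braided_monoidal_category
begin

lemma Arr_Braid [simp]: "\<lbrakk>a \<in> Obj C; b \<in> Obj C\<rbrakk> \<Longrightarrow> \<c> a b \<in> Arr C"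
  and Dom_Braid [simp]: "\<lbrakk>a \<in> Obj C; b \<in> Obj C\<rbrakk> \<Longrightarrow> Dom C (\<c> a b) = a \<otimes> b"
  and Cod_Braid [simp]: "\<lbrakk>a \<in> Obj C; b \<in> Obj C\<rbrakk> \<Longrightarrow> Cod C (\<c> a b) = b \<otimes> a"
  using Braid_hom[of a b] by (simp_all add: hom_iff)

lemma interchange_hom:
  "\<lbrakk>w \<in> Obj C; x \<in> Obj C; y \<in> Obj C; z \<in> Obj C\<rbrakk>
    \<Longrightarrow> interchange C w x y z \<in> hom C ((w \<otimes> x) \<otimes> (y \<otimes> z)) ((w \<otimes> y) \<otimes> (x \<otimes> z))"
  by (simp add: interchange_def hom_iff)

end


section \<open>Transport of monoidal structure along a bijection\<close>

text \<open>Here \<open>N\<close> is bare data. Each equation is oriented from \<open>N\<close> to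
  \<open>M\<close>, so an expression in images rewrites to the image of one expression of
  \<open>M\<close>; by surjectivity every axiom for \<open>N\<close> becomes the image of the same
  axiom for \<open>M\<close>.\<close>

locale monoidal_transport =
  source: monoidal_category M
  for M :: "('o, 'm, 'x) monoidal_data_scheme" (structure)
    and N :: "('p, 'n, 'y) monoidal_data_scheme"
    and G :: "'o \<Rightarrow> 'p"
    and F :: "'m \<Rightarrow> 'n" +
  assumes bij_G: "bij_betw G (Obj M) (Obj N)"
    and bij_F: "bij_betw F (Arr M) (Arr N)"
    and Dom_F: "f \<in> Arr M \<Longrightarrow> Dom N (F f) = G (Dom M f)"
    and Cod_F: "f \<in> Arr M \<Longrightarrow> Cod N (F f) = G (Cod M f)"
    and Ide_F: "a \<in> Obj M \<Longrightarrow> \<i>\<^bsub>N\<^esub> (G a) = F (\<i> a)"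
    and Comp_F: "\<lbrakk>f \<in> Arr M; g \<in> Arr M; Cod M f = Dom M g\<rbrakk>
      \<Longrightarrow> F g \<cdot>\<^bsub>N\<^esub> F f = F (g \<cdot> f)"
    and TensO_G: "\<lbrakk>a \<in> Obj M; b \<in> Obj M\<rbrakk> \<Longrightarrow> G a \<otimes>\<^bsub>N\<^esub> G b = G (a \<otimes> b)"
    and TensA_F: "\<lbrakk>f \<in> Arr M; g \<in> Arr M\<rbrakk> \<Longrightarrow> F f \<boxtimes>\<^bsub>N\<^esub> F g = F (f \<boxtimes> g)"
    and UnitO_G: "\<I>\<^bsub>N\<^esub> = G \<I>"
    and Assoc_F: "\<lbrakk>a \<in> Obj M; b \<in> Obj M; c \<in> Obj M\<rbrakk>
      \<Longrightarrow> \<a>\<^bsub>N\<^esub> (G a) (G b) (G c) = F (\<a> a b c)"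
    and LUnit_F: "a \<in> Obj M \<Longrightarrow> \<l>\<^bsub>N\<^esub> (G a) = F (\<l> a)"
    and RUnit_F: "a \<in> Obj M \<Longrightarrow> \<r>\<^bsub>N\<^esub> (G a) = F (\<r> a)"
begin

lemmas F_simps = Dom_F Cod_F Ide_F Comp_F TensO_G TensA_F UnitO_G Assoc_F LUnit_F RUnit_F

lemma G_Obj [simp]: "a \<in> Obj M \<Longrightarrow> G a \<in> Obj N"
  using bij_G by (auto simp: bij_betw_def)

lemma F_Arr [simp]: "f \<in> Arr M \<Longrightarrow> F f \<in> Arr N"
  using bij_F by (auto simp: bij_betw_def)

text \<open>Injectivity on objects lets composability in \<open>N\<close> descend to composability
  in \<open>M\<close>, as \<open>Comp_F\<close> requires.\<close>

lemma G_eq_iff [simp]: "\<lbrakk>a \<in> Obj M; b \<in> Obj M\<rbrakk> \<Longrightarrow> G a = G b \<longleftrightarrow> a = b"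
  using bij_G by (auto simp: bij_betw_def inj_on_def)

lemma Obj_cases:
  assumes "x \<in> Obj N"
  obtains a where "a \<in> Obj M" "x = G a"
  using assms bij_G by (auto simp: bij_betw_def)

lemma Arr_cases:
  assumes "u \<in> Arr N"
  obtains f where "f \<in> Arr M" "u = F f"
  using assms bij_F by (auto simp: bij_betw_def)

lemma hom_cases:
  assumes "u \<in> hom N x y"
  obtains f where "f \<in> Arr M" "u = F f" "x = G (Dom M f)" "y = G (Cod M f)"
  using assms Dom_F Cod_F by (auto simp: hom_iff elim: Arr_cases)

lemma iso_F:
  assumes "iso M f"
  shows "iso N (F f)"
proof -
  have "inverse_arrows N (F f) (F (inv_arr M f))"
    using assms source.iso_Arr[OF assms] by (simp add: inverse_arrows_def hom_iff F_simps)
  then show ?thesis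
    by (auto simp: iso_def)
qed

lemma category_target: "category N"
proof
  show "Dom N u \<in> Obj N" "Cod N u \<in> Obj N" if "u \<in> Arr N" for u
    using that by (auto elim!: Arr_cases simp: F_simps)
  show "\<i>\<^bsub>N\<^esub> x \<in> hom N x x" if "x \<in> Obj N" for x
    using that by (auto elim!: Obj_cases simp: F_simps hom_iff)
  show "v \<cdot>\<^bsub>N\<^esub> u \<in> hom N x z" if "u \<in> hom N x y" "v \<in> hom N y z" for u v x y z
    using that by (auto elim!: Arr_cases simp: F_simps hom_iff)
  show "u \<cdot>\<^bsub>N\<^esub> \<i>\<^bsub>N\<^esub> x = u" "\<i>\<^bsub>N\<^esub> y \<cdot>\<^bsub>N\<^esub> u = u" if "u \<in> hom N x y" for u x y
    using that by (auto elim!: hom_cases simp: F_simps)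
  show "(w \<cdot>\<^bsub>N\<^esub> v) \<cdot>\<^bsub>N\<^esub> u = w \<cdot>\<^bsub>N\<^esub> (v \<cdot>\<^bsub>N\<^esub> u)"
    if "u \<in> hom N x y" "v \<in> hom N y z" "w \<in> hom N z t" for u v w x y z t
    using that by (auto elim!: hom_cases simp: F_simps)
qed

lemma tensor_functor_target:
  "cat_functor (product_category N N) N (bifunctor_data (\<otimes>\<^bsub>N\<^esub>) (\<boxtimes>\<^bsub>N\<^esub>))"
proof -
  interpret N: category N
    by (rule category_target)
  note defs = product_category_def bifunctor_data_def hom_iff
  \<comment> \<open>The locale \<open>cat_functor\<close> includes the category axioms of its
    source, so these come first.\<close>
  interpret NN: category "product_category N N"
    by unfold_locales (auto simp: defs)
  show ?thesis
  proof
    fix x assume "x \<in> Obj (product_category N N)"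
    then show "onObj (bifunctor_data (\<otimes>\<^bsub>N\<^esub>) (\<boxtimes>\<^bsub>N\<^esub>)) x \<in> Obj N"
      and "onArr (bifunctor_data (\<otimes>\<^bsub>N\<^esub>) (\<boxtimes>\<^bsub>N\<^esub>)) (\<i>\<^bsub>product_category N N\<^esub> x)
        = \<i>\<^bsub>N\<^esub> (onObj (bifunctor_data (\<otimes>\<^bsub>N\<^esub>) (\<boxtimes>\<^bsub>N\<^esub>)) x)"
      by (auto simp: defs F_simps elim!: Obj_cases)
  next
    fix u x y assume "u \<in> hom (product_category N N) x y"
    then show "onArr (bifunctor_data (\<otimes>\<^bsub>N\<^esub>) (\<boxtimes>\<^bsub>N\<^esub>)) u
      \<in> hom N (onObj (bifunctor_data (\<otimes>\<^bsub>N\<^esub>) (\<boxtimes>\<^bsub>N\<^esub>)) x)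
              (onObj (bifunctor_data (\<otimes>\<^bsub>N\<^esub>) (\<boxtimes>\<^bsub>N\<^esub>)) y)"
      by (auto simp: defs F_simps elim!: Arr_cases)
  next
    fix u v x y z
    assume "u \<in> hom (product_category N N) x y" "v \<in> hom (product_category N N) y z"
    then show "onArr (bifunctor_data (\<otimes>\<^bsub>N\<^esub>) (\<boxtimes>\<^bsub>N\<^esub>)) (v \<cdot>\<^bsub>product_category N N\<^esub> u)
      = onArr (bifunctor_data (\<otimes>\<^bsub>N\<^esub>) (\<boxtimes>\<^bsub>N\<^esub>)) v \<cdot>\<^bsub>N\<^esub> onArr (bifunctor_data (\<otimes>\<^bsub>N\<^esub>) (\<boxtimes>\<^bsub>N\<^esub>)) u"
      by (auto simp: defs F_simps source.TensA_Comp elim!: Arr_cases)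
  qed
qed

lemma monoidal_category_target: "monoidal_category N"
\<comment> \<open>The cases follow the order of the axioms: category, tensor functor, unit object,
  then typing, invertibility and naturality of the associator (4-6), the left unit (7-9) and the
  right unit (10-12), then pentagon and triangle.\<close>
proof (intro monoidal_category.intro monoidal_category_axioms.intro, goal_cases)
  case 1
  show ?case by (rule category_target)
next
  case 2
  show ?case by (rule tensor_functor_target)
next
  case 3
  show ?case by (simp add: F_simps)
next
  case (4 x y z)
  then show ?case by (auto simp: F_simps hom_iff elim!: Obj_cases)
next
  case (5 x y z)
  then show ?case by (auto simp: F_simps iso_F elim!: Obj_cases)
next
  case (6 u x x' v y y' w z z')
  then show ?case
    by (auto simp: F_simps source.Assoc_natural hom_iff elim!: Arr_cases)
next
  case (7 x)
  then show ?case by (auto simp: F_simps hom_iff elim!: Obj_cases)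
next
  case (8 x)
  then show ?case by (auto simp: F_simps iso_F elim!: Obj_cases)
next
  case (9 u x y)
  then show ?case
    by (auto simp: F_simps source.LUnit_natural hom_iff elim!: Arr_cases)
next
  case (10 x)
  then show ?case by (auto simp: F_simps hom_iff elim!: Obj_cases)
next
  case (11 x)
  then show ?case by (auto simp: F_simps iso_F elim!: Obj_cases)
next
  case (12 u x y)
  then show ?case
    by (auto simp: F_simps source.RUnit_natural hom_iff elim!: Arr_cases)
next
  case (13 x y z t)
  then show ?case
    by (auto simp: F_simps source.pentagon elim!: Obj_cases)
next
  case (14 x y)
  then show ?case
    by (auto simp: F_simps source.triangle elim!: Obj_cases)
qed

lemma monoidal_isomorphism_target: "monoidal_isomorphism M N \<lparr>onObj = G, onArr = F\<rparr>"
proof -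
  interpret N: monoidal_category N
    by (rule monoidal_category_target)
  show ?thesis
    by unfold_locales (auto simp: F_simps hom_iff bij_G bij_F)
qed

end


section \<open>The enriched category of a closed action\<close>

context left_action
begin

lemma ActO_Obj [simp]: "\<lbrakk>X \<in> Obj V; a \<in> Obj A\<rbrakk> \<Longrightarrow> X \<star> a \<in> Obj A"
  by (rule bifunctor_Obj[OF action_functor])

lemma Arr_ActA [simp]: "\<lbrakk>f \<in> Arr V; g \<in> Arr A\<rbrakk> \<Longrightarrow> f \<odot> g \<in> Arr A"
  and Dom_ActA [simp]: "\<lbrakk>f \<in> Arr V; g \<in> Arr A\<rbrakk> \<Longrightarrow> Dom A (f \<odot> g) = Dom V f \<star> Dom A g"
  and Cod_ActA [simp]: "\<lbrakk>f \<in> Arr V; g \<in> Arr A\<rbrakk> \<Longrightarrow> Cod A (f \<odot> g) = Cod V f \<star> Cod A g"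
  using bifunctor_hom[OF action_functor, of f g] by (simp_all add: hom_iff)

lemma ActA_Ide [simp]: "\<lbrakk>X \<in> Obj V; a \<in> Obj A\<rbrakk> \<Longrightarrow> \<i>\<^bsub>V\<^esub> X \<odot> \<i>\<^bsub>A\<^esub> a = \<i>\<^bsub>A\<^esub> (X \<star> a)"
  by (rule bifunctor_Ide[OF action_functor])

lemma ActA_Comp: "\<lbrakk>f \<in> Arr V; f' \<in> Arr V; Cod V f = Dom V f';
    g \<in> Arr A; g' \<in> Arr A; Cod A g = Dom A g'\<rbrakk>
  \<Longrightarrow> (f' \<odot> g') \<cdot>\<^bsub>A\<^esub> (f \<odot> g) = (f' \<cdot>\<^bsub>V\<^esub> f) \<odot> (g' \<cdot>\<^bsub>A\<^esub> g)"
  by (rule bifunctor_Comp[OF action_functor])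

declare ActAssoc_iso [simp] ActUnit_iso [simp]

lemma Arr_ActAssoc [simp]: "\<lbrakk>X \<in> Obj V; Y \<in> Obj V; a \<in> Obj A\<rbrakk> \<Longrightarrow> \<alpha> X Y a \<in> Arr A"
  and Dom_ActAssoc [simp]:
    "\<lbrakk>X \<in> Obj V; Y \<in> Obj V; a \<in> Obj A\<rbrakk> \<Longrightarrow> Dom A (\<alpha> X Y a) = X \<star> (Y \<star> a)"
  and Cod_ActAssoc [simp]:
    "\<lbrakk>X \<in> Obj V; Y \<in> Obj V; a \<in> Obj A\<rbrakk> \<Longrightarrow> Cod A (\<alpha> X Y a) = (X \<otimes>\<^bsub>V\<^esub> Y) \<star> a"
  using ActAssoc_hom[of X Y a] by (simp_all add: hom_iff)

lemma Arr_ActUnit [simp]: "a \<in> Obj A \<Longrightarrow> \<lambda>\<lambda> a \<in> Arr A"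
  and Dom_ActUnit [simp]: "a \<in> Obj A \<Longrightarrow> Dom A (\<lambda>\<lambda> a) = \<I>\<^bsub>V\<^esub> \<star> a"
  and Cod_ActUnit [simp]: "a \<in> Obj A \<Longrightarrow> Cod A (\<lambda>\<lambda> a) = a"
  using ActUnit_hom[of a] by (simp_all add: hom_iff)

text \<open>The left triangle of the action solved for the inverse of \<open>\<alpha>\<close>, the
  form in which it meets enriched composition.\<close>

lemma LUnit_inv_ActAssoc:
  assumes "X \<in> Obj V" "a \<in> Obj A"
  shows "\<lambda>\<lambda> (X \<star> a) \<cdot>\<^bsub>A\<^esub> inv_arr A (\<alpha> \<I>\<^bsub>V\<^esub> X a) = \<l>\<^bsub>V\<^esub> X \<odot> \<i>\<^bsub>A\<^esub> a"
  using assms by (simp flip: action_triangle_left)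

lemma RUnit_inv_ActAssoc:
  assumes "X \<in> Obj V" "a \<in> Obj A"
  shows "(\<i>\<^bsub>V\<^esub> X \<odot> \<lambda>\<lambda> a) \<cdot>\<^bsub>A\<^esub> inv_arr A (\<alpha> X \<I>\<^bsub>V\<^esub> a) = \<r>\<^bsub>V\<^esub> X \<odot> \<i>\<^bsub>A\<^esub> a"
  using assms by (simp flip: action_triangle_right)

end

locale closed_action =
  left_action V A act
  for V :: "('v, 'm, 'x) monoidal_data_scheme"
    and A :: "('o, 'n, 'y) category_data_scheme"
    and act :: "('v, 'm, 'o, 'n) action_data" (structure) +
  fixes R :: "'o \<Rightarrow> ('v, 'm, 'o, 'n) right_adjoint_data"
  assumes act_adjunction: "a \<in> Obj A \<Longrightarrow> adjunction V A (act_on A act a) (R a)"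
begin

section \<open>The transposition bijection\<close>

abbreviation H :: "'o \<Rightarrow> 'o \<Rightarrow> 'v" where
  "H a b \<equiv> onObj (RightAdj (R a)) b"

abbreviation E :: "('o, 'v, 'm) Vcategory_data" where
  "E \<equiv> enriched_category V A act R"

text \<open>The inverse of \<open>transpose\<close>, that is, the operation written with a flat sign
  in the overview. Both objects are arguments because an arrow of \<open>V\<close> does not
  determine \<open>a\<close> and \<open>b\<close>.\<close>

definition uncurry :: "'o \<Rightarrow> 'o \<Rightarrow> 'm \<Rightarrow> 'n" where
  "uncurry a b f = Counit (R a) b \<cdot>\<^bsub>A\<^esub> (f \<odot> \<i>\<^bsub>A\<^esub> a)"

lemma H_Obj [simp]: "\<lbrakk>a \<in> Obj A; b \<in> Obj A\<rbrakk> \<Longrightarrow> H a b \<in> Obj V"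
proof -
  assume a: "a \<in> Obj A" and b: "b \<in> Obj A"
  interpret adjunction V A "act_on A act a" "R a"
    using a by (rule act_adjunction)
  show ?thesis
    using b by (rule right.onObj)
qed

lemma Counit_props:
  assumes a: "a \<in> Obj A" and b: "b \<in> Obj A"
  shows Arr_Counit [simp]: "Counit (R a) b \<in> Arr A"
    and Dom_Counit [simp]: "Dom A (Counit (R a) b) = H a b \<star> a"
    and Cod_Counit [simp]: "Cod A (Counit (R a) b) = b"
proof -
  interpret adjunction V A "act_on A act a" "R a"
    using a by (rule act_adjunction)
  show "Counit (R a) b \<in> Arr A" "Dom A (Counit (R a) b) = H a b \<star> a" "Cod A (Counit (R a) b) = b"
    using Counit_hom[OF b] by (simp_all add: hom_iff act_on_def)
qed

text \<open>Naturality of the unit moves \<open>f\<close> to the right end; the triangle identity at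
  \<open>b\<close> then removes the unit and the counit.\<close>

lemma transpose_uncurry:
  assumes a: "a \<in> Obj A" and b: "b \<in> Obj A" and f: "f \<in> hom V X (H a b)"
  shows "transpose V (R a) X (uncurry a b f) = f"
proof -
  interpret adjunction V A "act_on A act a" "R a"
    using a by (rule act_adjunction)
  have X: "X \<in> Obj V"
    using f by (auto simp: hom_iff)
  have Fhom: "f \<odot> \<i>\<^bsub>A\<^esub> a \<in> hom A (X \<star> a) (H a b \<star> a)"
    using f a by (simp add: hom_iff)
  have Rhom: "onArr (RightAdj (R a)) (f \<odot> \<i>\<^bsub>A\<^esub> a) \<in> hom V (H a (X \<star> a)) (H a (H a b \<star> a))"
    using right.onArr[OF Fhom] .
  have Chom: "Counit (R a) b \<in> hom A (H a b \<star> a) b"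
    using a b by (simp add: hom_iff)
  have RChom: "onArr (RightAdj (R a)) (Counit (R a) b) \<in> hom V (H a (H a b \<star> a)) (H a b)"
    using right.onArr[OF Chom] .
  have U: "Unit (R a) X \<in> hom V X (H a (X \<star> a))"
    and UH: "Unit (R a) (H a b) \<in> hom V (H a b) (H a (H a b \<star> a))"
    using Unit_hom[OF X] Unit_hom[of "H a b"] a b by (simp_all add: act_on_def)
  have "transpose V (R a) X (uncurry a b f)
      = onArr (RightAdj (R a)) (Counit (R a) b)
        \<cdot>\<^bsub>V\<^esub> (onArr (RightAdj (R a)) (f \<odot> \<i>\<^bsub>A\<^esub> a) \<cdot>\<^bsub>V\<^esub> Unit (R a) X)"
    using right.onArr_Comp[OF Fhom Chom] U Rhom RChom
    by (simp add: transpose_def uncurry_def hom_iff)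
  also have "\<dots> = onArr (RightAdj (R a)) (Counit (R a) b) \<cdot>\<^bsub>V\<^esub> Unit (R a) (H a b) \<cdot>\<^bsub>V\<^esub> f"
    using Unit_natural[OF f] by (simp add: act_on_def)
  also have "\<dots> = (onArr (RightAdj (R a)) (Counit (R a) b) \<cdot>\<^bsub>V\<^esub> Unit (R a) (H a b)) \<cdot>\<^bsub>V\<^esub> f"
    using f UH RChom by (simp add: hom_iff)
  also have "\<dots> = f"
    using triangle_right[OF b] f by (simp add: hom_iff)
  finally show ?thesis .
qed

text \<open>The mirror argument: naturality of the counit pulls \<open>f\<close> to the left end,
  and the triangle identity at \<open>X\<close> removes the rest.\<close>

lemma transpose_props:
  assumes a: "a \<in> Obj A" and b: "b \<in> Obj A" and X: "X \<in> Obj V" and f: "f \<in> hom A (X \<star> a) b"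
  shows transpose_hom: "transpose V (R a) X f \<in> hom V X (H a b)"
    and uncurry_transpose: "uncurry a b (transpose V (R a) X f) = f"
proof -
  interpret adjunction V A "act_on A act a" "R a"
    using a by (rule act_adjunction)
  have U: "Unit (R a) X \<in> hom V X (H a (X \<star> a))"
    using Unit_hom[OF X] by (simp add: act_on_def)
  have Rf: "onArr (RightAdj (R a)) f \<in> hom V (H a (X \<star> a)) (H a b)"
    using right.onArr[OF f] .
  show "transpose V (R a) X f \<in> hom V X (H a b)"
    using U Rf by (simp add: transpose_def hom_iff)
  have "uncurry a b (transpose V (R a) X f)
      = Counit (R a) b \<cdot>\<^bsub>A\<^esub> (onArr (RightAdj (R a)) f \<odot> \<i>\<^bsub>A\<^esub> a) \<cdot>\<^bsub>A\<^esub> (Unit (R a) X \<odot> \<i>\<^bsub>A\<^esub> a)"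
    using a U Rf by (simp add: uncurry_def transpose_def hom_iff ActA_Comp)
  also have "\<dots> = (Counit (R a) b \<cdot>\<^bsub>A\<^esub> (onArr (RightAdj (R a)) f \<odot> \<i>\<^bsub>A\<^esub> a)) \<cdot>\<^bsub>A\<^esub> (Unit (R a) X \<odot> \<i>\<^bsub>A\<^esub> a)"
    using a b U Rf by (simp add: hom_iff)
  also have "\<dots> = (f \<cdot>\<^bsub>A\<^esub> Counit (R a) (X \<star> a)) \<cdot>\<^bsub>A\<^esub> (Unit (R a) X \<odot> \<i>\<^bsub>A\<^esub> a)"
    using Counit_natural[OF f] by (simp add: act_on_def)
  also have "\<dots> = f \<cdot>\<^bsub>A\<^esub> (Counit (R a) (X \<star> a) \<cdot>\<^bsub>A\<^esub> (Unit (R a) X \<odot> \<i>\<^bsub>A\<^esub> a))"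
    using a X U f by (simp add: hom_iff)
  also have "\<dots> = f"
    using triangle_left[OF X] f by (simp add: act_on_def hom_iff)
  finally show "uncurry a b (transpose V (R a) X f) = f" .
qed

lemma uncurry_inject:
  assumes "a \<in> Obj A" "b \<in> Obj A" "f \<in> hom V X (H a b)" "g \<in> hom V X (H a b)"
    and "uncurry a b f = uncurry a b g"
  shows "f = g"
  using assms transpose_uncurry by metis

lemma uncurry_hom:
  assumes "a \<in> Obj A" "b \<in> Obj A" "f \<in> hom V X (H a b)"
  shows "uncurry a b f \<in> hom A (X \<star> a) b"
  using assms by (simp add: uncurry_def hom_iff)

text \<open>Naturality of transposition in the source. It peels off the structural arrows that are
  precomposed in \<open>V\<close>: inverse unit constraints, associators and
  \<open>interchange\<close>.\<close>

lemma uncurry_Comp: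
  assumes "a \<in> Obj A" "b \<in> Obj A" "f \<in> hom V X (H a b)" "k \<in> hom V Y X"
  shows "uncurry a b (f \<cdot>\<^bsub>V\<^esub> k) = uncurry a b f \<cdot>\<^bsub>A\<^esub> (k \<odot> \<i>\<^bsub>A\<^esub> a)"
  using assms by (simp add: uncurry_def hom_iff ActA_Comp)

lemma uncurry_Ide:
  assumes "a \<in> Obj A" "b \<in> Obj A"
  shows "uncurry a b (\<i>\<^bsub>V\<^esub> (H a b)) = Counit (R a) b"
  using assms by (simp add: uncurry_def)

section \<open>Composition and identities of the enriched category\<close>

lemma enriched_simps [simp]: "VObj E = Obj A" "VHom E = H"
  by (simp_all add: enriched_category_def)

text \<open>Follows from naturality of \<open>\<alpha>\<close> by cancelling
  \<open>\<alpha> X' Y' a'\<close> on the left.\<close>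

lemma inv_ActAssoc_natural:
  assumes "f \<in> hom V X X'" "g \<in> hom V Y Y'" "h \<in> hom A a a'"
  shows "(f \<odot> (g \<odot> h)) \<cdot>\<^bsub>A\<^esub> inv_arr A (\<alpha> X Y a)
    = inv_arr A (\<alpha> X' Y' a') \<cdot>\<^bsub>A\<^esub> ((f \<boxtimes>\<^bsub>V\<^esub> g) \<odot> h)"
proof (rule acted.iso_mono[where e = "\<alpha> X' Y' a'"])
  have objs: "X \<in> Obj V" "Y \<in> Obj V" "a \<in> Obj A" "X' \<in> Obj V" "Y' \<in> Obj V" "a' \<in> Obj A"
    using assms by (auto simp: hom_iff)
  note facts = assms[unfolded hom_iff] objs
  show "\<alpha> X' Y' a' \<cdot>\<^bsub>A\<^esub> (f \<odot> (g \<odot> h)) \<cdot>\<^bsub>A\<^esub> inv_arr A (\<alpha> X Y a)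
      = \<alpha> X' Y' a' \<cdot>\<^bsub>A\<^esub> inv_arr A (\<alpha> X' Y' a') \<cdot>\<^bsub>A\<^esub> ((f \<boxtimes>\<^bsub>V\<^esub> g) \<odot> h)"
  proof -
    have "\<alpha> X' Y' a' \<cdot>\<^bsub>A\<^esub> (f \<odot> (g \<odot> h)) \<cdot>\<^bsub>A\<^esub> inv_arr A (\<alpha> X Y a)
        = (\<alpha> X' Y' a' \<cdot>\<^bsub>A\<^esub> (f \<odot> (g \<odot> h))) \<cdot>\<^bsub>A\<^esub> inv_arr A (\<alpha> X Y a)"
      using facts by simp
    also have "\<dots> = (f \<boxtimes>\<^bsub>V\<^esub> g) \<odot> h"
      unfolding ActAssoc_natural[OF assms] using facts by simp
    also have "\<dots> = (\<alpha> X' Y' a' \<cdot>\<^bsub>A\<^esub> inv_arr A (\<alpha> X' Y' a')) \<cdot>\<^bsub>A\<^esub> ((f \<boxtimes>\<^bsub>V\<^esub> g) \<odot> h)"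
      using facts by simp
    finally show ?thesis
      using facts by (simp del: acted.Comp_inv_arr)
  qed
qed (use assms in \<open>auto simp: hom_iff\<close>)

lemma VComp_enriched_props:
  assumes objs: "a \<in> Obj A" "b \<in> Obj A" "c \<in> Obj A"
  shows VComp_enriched_hom: "VComp E a b c \<in> hom V (H b c \<otimes>\<^bsub>V\<^esub> H a b) (H a c)"
    and uncurry_VComp: "uncurry a c (VComp E a b c)
      = Counit (R b) c \<cdot>\<^bsub>A\<^esub> (\<i>\<^bsub>V\<^esub> (H b c) \<odot> Counit (R a) b)
        \<cdot>\<^bsub>A\<^esub> inv_arr A (\<alpha> (H b c) (H a b) a)"
proof -
  have "Counit (R b) c \<cdot>\<^bsub>A\<^esub> (\<i>\<^bsub>V\<^esub> (H b c) \<odot> Counit (R a) b)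
      \<cdot>\<^bsub>A\<^esub> inv_arr A (\<alpha> (H b c) (H a b) a) \<in> hom A ((H b c \<otimes>\<^bsub>V\<^esub> H a b) \<star> a) c"
    using objs by (simp add: hom_iff)
  note * = objs(1,3) _ this
  show "VComp E a b c \<in> hom V (H b c \<otimes>\<^bsub>V\<^esub> H a b) (H a c)"
    and "uncurry a c (VComp E a b c) = Counit (R b) c \<cdot>\<^bsub>A\<^esub> (\<i>\<^bsub>V\<^esub> (H b c) \<odot> Counit (R a) b)
        \<cdot>\<^bsub>A\<^esub> inv_arr A (\<alpha> (H b c) (H a b) a)"
    using transpose_hom[OF *] uncurry_transpose[OF *] objs by (simp_all add: enriched_category_def)
qed

lemma Arr_VComp [simp]:
  assumes "a \<in> Obj A" "b \<in> Obj A" "c \<in> Obj A"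
  shows "VComp E a b c \<in> Arr V" "Dom V (VComp E a b c) = H b c \<otimes>\<^bsub>V\<^esub> H a b"
    "Cod V (VComp E a b c) = H a c"
  using VComp_enriched_hom[OF assms] by (simp_all add: hom_iff)

lemma VIde_enriched_props:
  assumes a: "a \<in> Obj A"
  shows VIde_enriched_hom: "VIde E a \<in> hom V \<I>\<^bsub>V\<^esub> (H a a)"
    and uncurry_VIde: "uncurry a a (VIde E a) = \<lambda>\<lambda> a"
  using transpose_hom[OF a a _ ActUnit_hom[OF a]] uncurry_transpose[OF a a _ ActUnit_hom[OF a]]
  by (simp_all add: enriched_category_def)

lemma Arr_VIde [simp]:
  assumes "a \<in> Obj A"
  shows "VIde E a \<in> Arr V" "Dom V (VIde E a) = \<I>\<^bsub>V\<^esub>" "Cod V (VIde E a) = H a a"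
  using VIde_enriched_hom[OF assms] by (simp_all add: hom_iff)

lemma uncurry_VComp_TensA:
  assumes objs: "a \<in> Obj A" "b \<in> Obj A" "c \<in> Obj A"
    and g: "g \<in> hom V Y (H b c)" and f: "f \<in> hom V X (H a b)"
  shows "uncurry a c (VComp E a b c \<cdot>\<^bsub>V\<^esub> (g \<boxtimes>\<^bsub>V\<^esub> f))
    = uncurry b c g \<cdot>\<^bsub>A\<^esub> (\<i>\<^bsub>V\<^esub> Y \<odot> uncurry a b f) \<cdot>\<^bsub>A\<^esub> inv_arr A (\<alpha> Y X a)"
proof -
  have X: "X \<in> Obj V" "Y \<in> Obj V"
    using f g by (auto simp: hom_iff)
  note facts = objs X f[unfolded hom_iff] g[unfolded hom_iff]
  have ia: "\<i>\<^bsub>A\<^esub> a \<in> hom A a a"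
    using objs by (simp add: hom_iff)
  have "uncurry a c (VComp E a b c \<cdot>\<^bsub>V\<^esub> (g \<boxtimes>\<^bsub>V\<^esub> f))
      = Counit (R b) c \<cdot>\<^bsub>A\<^esub> (\<i>\<^bsub>V\<^esub> (H b c) \<odot> Counit (R a) b)
        \<cdot>\<^bsub>A\<^esub> inv_arr A (\<alpha> (H b c) (H a b) a) \<cdot>\<^bsub>A\<^esub> ((g \<boxtimes>\<^bsub>V\<^esub> f) \<odot> \<i>\<^bsub>A\<^esub> a)"
    using facts
    by (subst uncurry_Comp[where X = "H b c \<otimes>\<^bsub>V\<^esub> H a b" and Y = "Y \<otimes>\<^bsub>V\<^esub> X"])
      (simp_all add: hom_iff uncurry_VComp)
  also have "\<dots> = Counit (R b) c \<cdot>\<^bsub>A\<^esub> (\<i>\<^bsub>V\<^esub> (H b c) \<odot> Counit (R a) b)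
        \<cdot>\<^bsub>A\<^esub> (g \<odot> (f \<odot> \<i>\<^bsub>A\<^esub> a)) \<cdot>\<^bsub>A\<^esub> inv_arr A (\<alpha> Y X a)"
    by (simp only: inv_ActAssoc_natural[OF g f ia])
  also have "\<dots> = Counit (R b) c \<cdot>\<^bsub>A\<^esub> ((\<i>\<^bsub>V\<^esub> (H b c) \<odot> Counit (R a) b)
        \<cdot>\<^bsub>A\<^esub> (g \<odot> (f \<odot> \<i>\<^bsub>A\<^esub> a))) \<cdot>\<^bsub>A\<^esub> inv_arr A (\<alpha> Y X a)"
    using facts by simp
  \<comment> \<open>By the interchange law the counit of \<open>a\<close> absorbs \<open>f\<close>
    in the second argument of the action, while \<open>g\<close> is moved to the left, where the
    counit of \<open>b\<close> absorbs it.\<close>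
  also have "\<dots> = Counit (R b) c \<cdot>\<^bsub>A\<^esub> ((g \<odot> \<i>\<^bsub>A\<^esub> b)
        \<cdot>\<^bsub>A\<^esub> (\<i>\<^bsub>V\<^esub> Y \<odot> uncurry a b f)) \<cdot>\<^bsub>A\<^esub> inv_arr A (\<alpha> Y X a)"
    using facts by (simp add: ActA_Comp uncurry_def)
  also have "\<dots> = uncurry b c g \<cdot>\<^bsub>A\<^esub> (\<i>\<^bsub>V\<^esub> Y \<odot> uncurry a b f) \<cdot>\<^bsub>A\<^esub> inv_arr A (\<alpha> Y X a)"
    using facts by (simp add: uncurry_def)
  finally show ?thesis .
qed

text \<open>The action pentagon with three of its \<open>\<alpha>\<close> factors inverted, obtained
  by cancelling the two on the right one after the other. It rebrackets the tail of a triple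
  enriched composite.\<close>

lemma action_pentagon_inverse:
  assumes objs: "X \<in> Obj V" "Y \<in> Obj V" "Z \<in> Obj V" "a \<in> Obj A"
  shows "(\<i>\<^bsub>V\<^esub> X \<odot> inv_arr A (\<alpha> Y Z a)) \<cdot>\<^bsub>A\<^esub> inv_arr A (\<alpha> X (Y \<otimes>\<^bsub>V\<^esub> Z) a)
      \<cdot>\<^bsub>A\<^esub> (\<a>\<^bsub>V\<^esub> X Y Z \<odot> \<i>\<^bsub>A\<^esub> a)
    = inv_arr A (\<alpha> X Y (Z \<star> a)) \<cdot>\<^bsub>A\<^esub> inv_arr A (\<alpha> (X \<otimes>\<^bsub>V\<^esub> Y) Z a)" (is "?l = ?r")
proof (rule acted.iso_epi[where e = "\<alpha> (X \<otimes>\<^bsub>V\<^esub> Y) Z a"])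
  show "?l \<cdot>\<^bsub>A\<^esub> \<alpha> (X \<otimes>\<^bsub>V\<^esub> Y) Z a = ?r \<cdot>\<^bsub>A\<^esub> \<alpha> (X \<otimes>\<^bsub>V\<^esub> Y) Z a"
  proof (rule acted.iso_epi[where e = "\<alpha> X Y (Z \<star> a)"])
    have "(?l \<cdot>\<^bsub>A\<^esub> \<alpha> (X \<otimes>\<^bsub>V\<^esub> Y) Z a) \<cdot>\<^bsub>A\<^esub> \<alpha> X Y (Z \<star> a)
        = (\<i>\<^bsub>V\<^esub> X \<odot> inv_arr A (\<alpha> Y Z a)) \<cdot>\<^bsub>A\<^esub> inv_arr A (\<alpha> X (Y \<otimes>\<^bsub>V\<^esub> Z) a)
          \<cdot>\<^bsub>A\<^esub> \<alpha> X (Y \<otimes>\<^bsub>V\<^esub> Z) a \<cdot>\<^bsub>A\<^esub> (\<i>\<^bsub>V\<^esub> X \<odot> \<alpha> Y Z a)"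
      using objs by (simp add: action_pentagon)
    also have "\<dots> = (\<i>\<^bsub>V\<^esub> X \<odot> inv_arr A (\<alpha> Y Z a))
          \<cdot>\<^bsub>A\<^esub> (inv_arr A (\<alpha> X (Y \<otimes>\<^bsub>V\<^esub> Z) a) \<cdot>\<^bsub>A\<^esub> \<alpha> X (Y \<otimes>\<^bsub>V\<^esub> Z) a) \<cdot>\<^bsub>A\<^esub> (\<i>\<^bsub>V\<^esub> X \<odot> \<alpha> Y Z a)"
      using objs by (simp del: acted.inv_arr_Comp)
    also have "\<dots> = \<i>\<^bsub>A\<^esub> (X \<star> (Y \<star> (Z \<star> a)))"
      using objs by (simp add: ActA_Comp)
    also have "\<dots> = (?r \<cdot>\<^bsub>A\<^esub> \<alpha> (X \<otimes>\<^bsub>V\<^esub> Y) Z a) \<cdot>\<^bsub>A\<^esub> \<alpha> X Y (Z \<star> a)"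
      using objs by simp
    finally show "(?l \<cdot>\<^bsub>A\<^esub> \<alpha> (X \<otimes>\<^bsub>V\<^esub> Y) Z a) \<cdot>\<^bsub>A\<^esub> \<alpha> X Y (Z \<star> a)
      = (?r \<cdot>\<^bsub>A\<^esub> \<alpha> (X \<otimes>\<^bsub>V\<^esub> Y) Z a) \<cdot>\<^bsub>A\<^esub> \<alpha> X Y (Z \<star> a)" .
  qed (use objs in simp_all)
qed (use objs in simp_all)

text \<open>Both sides transpose to three nested counits after inverses of \<open>\<alpha>\<close>.
  Naturality brings the innermost counit in front of those inverses, the inverted pentagon
  rebrackets them, and functoriality of acting by \<open>H c d\<close> reassembles the inner
  composite.\<close>

lemma VComp_enriched_assoc:
  assumes objs: "a \<in> Obj A" "b \<in> Obj A" "c \<in> Obj A" "d \<in> Obj A"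
  shows "VComp E a b d \<cdot>\<^bsub>V\<^esub> (VComp E b c d \<boxtimes>\<^bsub>V\<^esub> \<i>\<^bsub>V\<^esub> (H a b))
    = VComp E a c d \<cdot>\<^bsub>V\<^esub> (\<i>\<^bsub>V\<^esub> (H c d) \<boxtimes>\<^bsub>V\<^esub> VComp E a b c) \<cdot>\<^bsub>V\<^esub> \<a>\<^bsub>V\<^esub> (H c d) (H b c) (H a b)"
    (is "?l = ?r")
proof (rule uncurry_inject[where X = "(H c d \<otimes>\<^bsub>V\<^esub> H b c) \<otimes>\<^bsub>V\<^esub> H a b"])
  let ?P = "H c d" and ?Q = "H b c" and ?S = "H a b"
  let ?\<epsilon> = "\<lambda>a b. Counit (R a) b"
  have *: "\<i>\<^bsub>V\<^esub> ?P \<in> hom V ?P ?P" "\<i>\<^bsub>V\<^esub> ?Q \<in> hom V ?Q ?Q" "?\<epsilon> a b \<in> hom A (?S \<star> a) b"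
    using objs by (simp_all add: hom_iff)
  have "uncurry a d ?l = uncurry b d (VComp E b c d) \<cdot>\<^bsub>A\<^esub> (\<i>\<^bsub>V\<^esub> (?P \<otimes>\<^bsub>V\<^esub> ?Q) \<odot> ?\<epsilon> a b)
      \<cdot>\<^bsub>A\<^esub> inv_arr A (\<alpha> (?P \<otimes>\<^bsub>V\<^esub> ?Q) ?S a)"
    using objs by (subst uncurry_VComp_TensA) (simp_all add: hom_iff uncurry_Ide)
  \<comment> \<open>The identity of the tensor \<open>?P\<close> with \<open>?Q\<close> is written
    as a tensor of identities, which is the shape that naturality of the inverse of
    \<open>\<alpha>\<close> expects.\<close>
  also have "\<dots> = ?\<epsilon> c d \<cdot>\<^bsub>A\<^esub> (\<i>\<^bsub>V\<^esub> ?P \<odot> ?\<epsilon> b c)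
      \<cdot>\<^bsub>A\<^esub> (inv_arr A (\<alpha> ?P ?Q b) \<cdot>\<^bsub>A\<^esub> ((\<i>\<^bsub>V\<^esub> ?P \<boxtimes>\<^bsub>V\<^esub> \<i>\<^bsub>V\<^esub> ?Q) \<odot> ?\<epsilon> a b))
      \<cdot>\<^bsub>A\<^esub> inv_arr A (\<alpha> (?P \<otimes>\<^bsub>V\<^esub> ?Q) ?S a)"
    using objs by (simp add: uncurry_VComp)
  also have "\<dots> = ?\<epsilon> c d \<cdot>\<^bsub>A\<^esub> (\<i>\<^bsub>V\<^esub> ?P \<odot> ?\<epsilon> b c) \<cdot>\<^bsub>A\<^esub> (\<i>\<^bsub>V\<^esub> ?P \<odot> (\<i>\<^bsub>V\<^esub> ?Q \<odot> ?\<epsilon> a b))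
      \<cdot>\<^bsub>A\<^esub> inv_arr A (\<alpha> ?P ?Q (?S \<star> a)) \<cdot>\<^bsub>A\<^esub> inv_arr A (\<alpha> (?P \<otimes>\<^bsub>V\<^esub> ?Q) ?S a)"
    unfolding inv_ActAssoc_natural[OF *, symmetric] using objs by simp
  also have "\<dots> = ?\<epsilon> c d \<cdot>\<^bsub>A\<^esub> (\<i>\<^bsub>V\<^esub> ?P \<odot> ?\<epsilon> b c) \<cdot>\<^bsub>A\<^esub> (\<i>\<^bsub>V\<^esub> ?P \<odot> (\<i>\<^bsub>V\<^esub> ?Q \<odot> ?\<epsilon> a b))
      \<cdot>\<^bsub>A\<^esub> (\<i>\<^bsub>V\<^esub> ?P \<odot> inv_arr A (\<alpha> ?Q ?S a)) \<cdot>\<^bsub>A\<^esub> inv_arr A (\<alpha> ?P (?Q \<otimes>\<^bsub>V\<^esub> ?S) a)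
      \<cdot>\<^bsub>A\<^esub> (\<a>\<^bsub>V\<^esub> ?P ?Q ?S \<odot> \<i>\<^bsub>A\<^esub> a)"
    using objs by (simp add: action_pentagon_inverse)
  also have "\<dots> = ?\<epsilon> c d \<cdot>\<^bsub>A\<^esub> ((\<i>\<^bsub>V\<^esub> ?P \<odot> ?\<epsilon> b c) \<cdot>\<^bsub>A\<^esub> (\<i>\<^bsub>V\<^esub> ?P \<odot> (\<i>\<^bsub>V\<^esub> ?Q \<odot> ?\<epsilon> a b))
      \<cdot>\<^bsub>A\<^esub> (\<i>\<^bsub>V\<^esub> ?P \<odot> inv_arr A (\<alpha> ?Q ?S a))) \<cdot>\<^bsub>A\<^esub> inv_arr A (\<alpha> ?P (?Q \<otimes>\<^bsub>V\<^esub> ?S) a)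
      \<cdot>\<^bsub>A\<^esub> (\<a>\<^bsub>V\<^esub> ?P ?Q ?S \<odot> \<i>\<^bsub>A\<^esub> a)"
    using objs by simp
  also have "\<dots> = ?\<epsilon> c d \<cdot>\<^bsub>A\<^esub> (\<i>\<^bsub>V\<^esub> ?P \<odot> uncurry a c (VComp E a b c))
      \<cdot>\<^bsub>A\<^esub> inv_arr A (\<alpha> ?P (?Q \<otimes>\<^bsub>V\<^esub> ?S) a) \<cdot>\<^bsub>A\<^esub> (\<a>\<^bsub>V\<^esub> ?P ?Q ?S \<odot> \<i>\<^bsub>A\<^esub> a)"
    using objs by (simp add: ActA_Comp uncurry_VComp)
  also have "\<dots> = uncurry a d (VComp E a c d \<cdot>\<^bsub>V\<^esub> (\<i>\<^bsub>V\<^esub> ?P \<boxtimes>\<^bsub>V\<^esub> VComp E a b c))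
      \<cdot>\<^bsub>A\<^esub> (\<a>\<^bsub>V\<^esub> ?P ?Q ?S \<odot> \<i>\<^bsub>A\<^esub> a)"
    using objs uncurry_hom[OF _ _ VComp_enriched_hom[of a b c]]
    by (subst uncurry_VComp_TensA[where X = "?Q \<otimes>\<^bsub>V\<^esub> ?S" and Y = ?P])
      (simp_all add: hom_iff uncurry_Ide)
  also have "\<dots> = uncurry a d ?r"
    using objs by (subst uncurry_Comp[symmetric]) (simp_all add: hom_iff)
  finally show "uncurry a d ?l = uncurry a d ?r" .
qed (use objs in \<open>simp_all add: hom_iff\<close>)

text \<open>Naturality moves \<open>\<lambda>\<lambda>\<close> past the counit, and the left
  triangle of the action then produces \<open>\<l>\<close>.\<close>

lemma VIde_VComp_enriched:
  assumes objs: "a \<in> Obj A" "b \<in> Obj A"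
  shows "VComp E a b b \<cdot>\<^bsub>V\<^esub> (VIde E b \<boxtimes>\<^bsub>V\<^esub> \<i>\<^bsub>V\<^esub> (H a b)) = \<l>\<^bsub>V\<^esub> (H a b)" (is "?l = ?r")
proof (rule uncurry_inject[where X = "\<I>\<^bsub>V\<^esub> \<otimes>\<^bsub>V\<^esub> H a b"])
  let ?\<epsilon> = "Counit (R a) b"
  have \<epsilon>: "?\<epsilon> \<in> hom A (H a b \<star> a) b"
    using objs by (simp add: hom_iff)
  have "uncurry a b ?l = (\<lambda>\<lambda> b \<cdot>\<^bsub>A\<^esub> (\<i>\<^bsub>V\<^esub> \<I>\<^bsub>V\<^esub> \<odot> ?\<epsilon>)) \<cdot>\<^bsub>A\<^esub> inv_arr A (\<alpha> \<I>\<^bsub>V\<^esub> (H a b) a)"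
    using objs
    by (subst uncurry_VComp_TensA) (simp_all add: hom_iff uncurry_Ide uncurry_VIde)
  also have "\<dots> = ?\<epsilon> \<cdot>\<^bsub>A\<^esub> (\<l>\<^bsub>V\<^esub> (H a b) \<odot> \<i>\<^bsub>A\<^esub> a)"
    unfolding ActUnit_natural[OF \<epsilon>] using objs by (simp add: LUnit_inv_ActAssoc)
  finally show "uncurry a b ?l = uncurry a b ?r"
    by (simp add: uncurry_def)
qed (use objs in \<open>simp_all add: hom_iff\<close>)

text \<open>The transpose ends in the right triangle of the action, which produces
  \<open>\<r>\<close>.\<close>

lemma VComp_VIde_enriched:
  assumes objs: "a \<in> Obj A" "b \<in> Obj A"
  shows "VComp E a a b \<cdot>\<^bsub>V\<^esub> (\<i>\<^bsub>V\<^esub> (H a b) \<boxtimes>\<^bsub>V\<^esub> VIde E a) = \<r>\<^bsub>V\<^esub> (H a b)" (is "?l = ?r")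
proof (rule uncurry_inject[where X = "H a b \<otimes>\<^bsub>V\<^esub> \<I>\<^bsub>V\<^esub>"])
  have "uncurry a b ?l = Counit (R a) b \<cdot>\<^bsub>A\<^esub> (\<r>\<^bsub>V\<^esub> (H a b) \<odot> \<i>\<^bsub>A\<^esub> a)"
    using objs
    by (subst uncurry_VComp_TensA)
      (simp_all add: hom_iff uncurry_Ide uncurry_VIde flip: RUnit_inv_ActAssoc)
  then show "uncurry a b ?l = uncurry a b ?r"
    by (simp add: uncurry_def)
qed (use objs in \<open>simp_all add: hom_iff\<close>)

lemma V_category_enriched: "V_category V E"
  by unfold_locales
    (simp_all add: hom_iff VComp_enriched_assoc VIde_VComp_enriched VComp_VIde_enriched)

section \<open>Names of arrows and the underlying category\<close>

abbreviation name :: "'n \<Rightarrow> 'm" where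
  "name \<equiv> arrow_name V A act R"

lemma name_props:
  assumes f: "f \<in> hom A a b"
  shows name_hom: "name f \<in> hom V \<I>\<^bsub>V\<^esub> (H a b)"
    and uncurry_name: "uncurry a b (name f) = f \<cdot>\<^bsub>A\<^esub> \<lambda>\<lambda> a"
proof -
  have a: "a \<in> Obj A" and b: "b \<in> Obj A"
    using f by (auto simp: hom_iff)
  have *: "f \<cdot>\<^bsub>A\<^esub> \<lambda>\<lambda> a \<in> hom A (\<I>\<^bsub>V\<^esub> \<star> a) b"
    using f a by (simp add: hom_iff)
  show "name f \<in> hom V \<I>\<^bsub>V\<^esub> (H a b)" and "uncurry a b (name f) = f \<cdot>\<^bsub>A\<^esub> \<lambda>\<lambda> a"
    using transpose_hom[OF a b _ *] uncurry_transpose[OF a b _ *] f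
    by (simp_all add: arrow_name_def hom_iff)
qed

lemma Arr_name [simp]:
  assumes "f \<in> Arr A"
  shows "name f \<in> Arr V" "Dom V (name f) = \<I>\<^bsub>V\<^esub>" "Cod V (name f) = H (Dom A f) (Cod A f)"
  using name_hom[of f "Dom A f" "Cod A f"] assms by (simp_all add: hom_iff)

lemma name_Ide: "a \<in> Obj A \<Longrightarrow> name (\<i>\<^bsub>A\<^esub> a) = VIde E a"
  by (simp add: arrow_name_def enriched_category_def)

text \<open>Naturality moves \<open>\<lambda>\<lambda>\<close> past \<open>uncurry a b f\<close>;
  the left triangle turns it into \<open>\<l>\<close>, which cancels the inserted inverse. This
  serves both composition of names and one side of each \<open>V\<close>-naturality square.\<close>

lemma uncurry_name_VComp:
  assumes g: "g \<in> hom A b c" and a: "a \<in> Obj A" and f: "f \<in> hom V X (H a b)"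
  shows "uncurry a c (VComp E a b c \<cdot>\<^bsub>V\<^esub> (name g \<boxtimes>\<^bsub>V\<^esub> f) \<cdot>\<^bsub>V\<^esub> inv_arr V (\<l>\<^bsub>V\<^esub> X))
    = g \<cdot>\<^bsub>A\<^esub> uncurry a b f"
proof -
  have objs: "a \<in> Obj A" "b \<in> Obj A" "c \<in> Obj A" "X \<in> Obj V"
    using assms by (auto simp: hom_iff)
  have u: "uncurry a b f \<in> hom A (X \<star> a) b"
    using objs f by (intro uncurry_hom)
  note facts = objs f[unfolded hom_iff] g[unfolded hom_iff] u[unfolded hom_iff]
  have "uncurry a c (VComp E a b c \<cdot>\<^bsub>V\<^esub> (name g \<boxtimes>\<^bsub>V\<^esub> f) \<cdot>\<^bsub>V\<^esub> inv_arr V (\<l>\<^bsub>V\<^esub> X))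
      = uncurry a c (VComp E a b c \<cdot>\<^bsub>V\<^esub> (name g \<boxtimes>\<^bsub>V\<^esub> f)) \<cdot>\<^bsub>A\<^esub> (inv_arr V (\<l>\<^bsub>V\<^esub> X) \<odot> \<i>\<^bsub>A\<^esub> a)"
    using facts by (subst uncurry_Comp[symmetric]) (auto simp: hom_iff)
  also have "\<dots> = ((g \<cdot>\<^bsub>A\<^esub> \<lambda>\<lambda> b) \<cdot>\<^bsub>A\<^esub> (\<i>\<^bsub>V\<^esub> \<I>\<^bsub>V\<^esub> \<odot> uncurry a b f) \<cdot>\<^bsub>A\<^esub> inv_arr A (\<alpha> \<I>\<^bsub>V\<^esub> X a))
      \<cdot>\<^bsub>A\<^esub> (inv_arr V (\<l>\<^bsub>V\<^esub> X) \<odot> \<i>\<^bsub>A\<^esub> a)"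
    using objs uncurry_VComp_TensA[OF objs(1,2,3) name_hom[OF g] f] by (simp add: uncurry_name[OF g])
  also have "\<dots> = g \<cdot>\<^bsub>A\<^esub> (\<lambda>\<lambda> b \<cdot>\<^bsub>A\<^esub> (\<i>\<^bsub>V\<^esub> \<I>\<^bsub>V\<^esub> \<odot> uncurry a b f)) \<cdot>\<^bsub>A\<^esub> inv_arr A (\<alpha> \<I>\<^bsub>V\<^esub> X a)
      \<cdot>\<^bsub>A\<^esub> (inv_arr V (\<l>\<^bsub>V\<^esub> X) \<odot> \<i>\<^bsub>A\<^esub> a)"
    using facts by simp
  also have "\<dots> = g \<cdot>\<^bsub>A\<^esub> uncurry a b f \<cdot>\<^bsub>A\<^esub> (\<lambda>\<lambda> (X \<star> a) \<cdot>\<^bsub>A\<^esub> inv_arr A (\<alpha> \<I>\<^bsub>V\<^esub> X a))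
      \<cdot>\<^bsub>A\<^esub> (inv_arr V (\<l>\<^bsub>V\<^esub> X) \<odot> \<i>\<^bsub>A\<^esub> a)"
    unfolding ActUnit_natural[OF u] using facts by simp
  also have "\<dots> = g \<cdot>\<^bsub>A\<^esub> uncurry a b f"
    unfolding LUnit_inv_ActAssoc[OF objs(4,1)] using facts by (simp add: ActA_Comp)
  finally show ?thesis .
qed

text \<open>The other side of a \<open>V\<close>-naturality square: functoriality of the action
  splits off \<open>h\<close>, and the right triangle cancels the inserted inverse of
  \<open>\<r>\<close>.\<close>

lemma uncurry_VComp_name:
  assumes f: "f \<in> hom V X (H b c)" and c: "c \<in> Obj A" and h: "h \<in> hom A a b"
  shows "uncurry a c (VComp E a b c \<cdot>\<^bsub>V\<^esub> (f \<boxtimes>\<^bsub>V\<^esub> name h) \<cdot>\<^bsub>V\<^esub> inv_arr V (\<r>\<^bsub>V\<^esub> X))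
    = uncurry b c f \<cdot>\<^bsub>A\<^esub> (\<i>\<^bsub>V\<^esub> X \<odot> h)"
proof -
  have objs: "a \<in> Obj A" "b \<in> Obj A" "c \<in> Obj A" "X \<in> Obj V"
    using assms by (auto simp: hom_iff)
  have u: "uncurry b c f \<in> hom A (X \<star> b) c"
    using objs f by (intro uncurry_hom)
  note facts = objs f[unfolded hom_iff] h[unfolded hom_iff] u[unfolded hom_iff]
  have "uncurry a c (VComp E a b c \<cdot>\<^bsub>V\<^esub> (f \<boxtimes>\<^bsub>V\<^esub> name h) \<cdot>\<^bsub>V\<^esub> inv_arr V (\<r>\<^bsub>V\<^esub> X))
      = uncurry a c (VComp E a b c \<cdot>\<^bsub>V\<^esub> (f \<boxtimes>\<^bsub>V\<^esub> name h)) \<cdot>\<^bsub>A\<^esub> (inv_arr V (\<r>\<^bsub>V\<^esub> X) \<odot> \<i>\<^bsub>A\<^esub> a)"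
    using facts by (subst uncurry_Comp[symmetric]) (auto simp: hom_iff)
  also have "\<dots> = (uncurry b c f \<cdot>\<^bsub>A\<^esub> (\<i>\<^bsub>V\<^esub> X \<odot> (h \<cdot>\<^bsub>A\<^esub> \<lambda>\<lambda> a)) \<cdot>\<^bsub>A\<^esub> inv_arr A (\<alpha> X \<I>\<^bsub>V\<^esub> a))
      \<cdot>\<^bsub>A\<^esub> (inv_arr V (\<r>\<^bsub>V\<^esub> X) \<odot> \<i>\<^bsub>A\<^esub> a)"
    using objs uncurry_VComp_TensA[OF objs(1,2,3) f name_hom[OF h]] by (simp add: uncurry_name[OF h])
  also have "\<dots> = (uncurry b c f \<cdot>\<^bsub>A\<^esub> ((\<i>\<^bsub>V\<^esub> X \<odot> h) \<cdot>\<^bsub>A\<^esub> (\<i>\<^bsub>V\<^esub> X \<odot> \<lambda>\<lambda> a)) \<cdot>\<^bsub>A\<^esub> inv_arr A (\<alpha> X \<I>\<^bsub>V\<^esub> a))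
      \<cdot>\<^bsub>A\<^esub> (inv_arr V (\<r>\<^bsub>V\<^esub> X) \<odot> \<i>\<^bsub>A\<^esub> a)"
    using facts by (simp add: ActA_Comp)
  also have "\<dots> = uncurry b c f \<cdot>\<^bsub>A\<^esub> (\<i>\<^bsub>V\<^esub> X \<odot> h)
      \<cdot>\<^bsub>A\<^esub> ((\<i>\<^bsub>V\<^esub> X \<odot> \<lambda>\<lambda> a) \<cdot>\<^bsub>A\<^esub> inv_arr A (\<alpha> X \<I>\<^bsub>V\<^esub> a)) \<cdot>\<^bsub>A\<^esub> (inv_arr V (\<r>\<^bsub>V\<^esub> X) \<odot> \<i>\<^bsub>A\<^esub> a)"
    using facts by simp
  also have "\<dots> = uncurry b c f \<cdot>\<^bsub>A\<^esub> (\<i>\<^bsub>V\<^esub> X \<odot> h)"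
    unfolding RUnit_inv_ActAssoc[OF objs(4,1)] using facts by (simp add: ActA_Comp)
  finally show ?thesis .
qed

text \<open>The case \<open>X = I\<close> of \<open>uncurry_name_VComp\<close> with a name as second
  factor.\<close>

lemma name_Comp:
  assumes f: "f \<in> hom A a b" and g: "g \<in> hom A b c"
  shows "VComp E a b c \<cdot>\<^bsub>V\<^esub> (name g \<boxtimes>\<^bsub>V\<^esub> name f) \<cdot>\<^bsub>V\<^esub> inv_arr V (\<l>\<^bsub>V\<^esub> \<I>\<^bsub>V\<^esub>) = name (g \<cdot>\<^bsub>A\<^esub> f)"
proof (rule uncurry_inject[where X = "\<I>\<^bsub>V\<^esub>"])
  have objs: "a \<in> Obj A" "b \<in> Obj A" "c \<in> Obj A"
    using assms by (auto simp: hom_iff)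
  show "a \<in> Obj A" "c \<in> Obj A"
    by fact+
  show "VComp E a b c \<cdot>\<^bsub>V\<^esub> (name g \<boxtimes>\<^bsub>V\<^esub> name f) \<cdot>\<^bsub>V\<^esub> inv_arr V (\<l>\<^bsub>V\<^esub> \<I>\<^bsub>V\<^esub>) \<in> hom V \<I>\<^bsub>V\<^esub> (H a c)"
    "name (g \<cdot>\<^bsub>A\<^esub> f) \<in> hom V \<I>\<^bsub>V\<^esub> (H a c)"
    using assms by (auto simp: hom_iff)
  show "uncurry a c (VComp E a b c \<cdot>\<^bsub>V\<^esub> (name g \<boxtimes>\<^bsub>V\<^esub> name f) \<cdot>\<^bsub>V\<^esub> inv_arr V (\<l>\<^bsub>V\<^esub> \<I>\<^bsub>V\<^esub>))
      = uncurry a c (name (g \<cdot>\<^bsub>A\<^esub> f))"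
    using assms objs uncurry_name_VComp[OF g objs(1) name_hom[OF f]]
      uncurry_name[OF f] uncurry_name[OF acted.Comp_hom[OF f g]]
    by (simp add: hom_iff)
qed

text \<open>Naming is precomposition with the invertible \<open>\<lambda>\<lambda> a\<close>
  followed by transposition; the witness undoes these two bijections in reverse order.\<close>

lemma name_bij:
  assumes objs: "a \<in> Obj A" "b \<in> Obj A"
  shows "bij_betw name (hom A a b) (hom V \<I>\<^bsub>V\<^esub> (H a b))"
proof (rule bij_betw_byWitness[where f' = "\<lambda>k. uncurry a b k \<cdot>\<^bsub>A\<^esub> inv_arr A (\<lambda>\<lambda> a)"])
  show "\<forall>f \<in> hom A a b. uncurry a b (name f) \<cdot>\<^bsub>A\<^esub> inv_arr A (\<lambda>\<lambda> a) = f"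
    using objs by (simp add: uncurry_name) (simp add: hom_iff)
  have inv: "uncurry a b k \<cdot>\<^bsub>A\<^esub> inv_arr A (\<lambda>\<lambda> a) \<in> hom A a b" if "k \<in> hom V \<I>\<^bsub>V\<^esub> (H a b)" for k
    using uncurry_hom[OF objs that] objs by (simp add: hom_iff)
  then show "(\<lambda>k. uncurry a b k \<cdot>\<^bsub>A\<^esub> inv_arr A (\<lambda>\<lambda> a)) ` hom V \<I>\<^bsub>V\<^esub> (H a b) \<subseteq> hom A a b"
    by auto
  show "name ` hom A a b \<subseteq> hom V \<I>\<^bsub>V\<^esub> (H a b)"
    using name_hom by auto
  show "\<forall>k \<in> hom V \<I>\<^bsub>V\<^esub> (H a b). name (uncurry a b k \<cdot>\<^bsub>A\<^esub> inv_arr A (\<lambda>\<lambda> a)) = k"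
  proof
    fix k assume k: "k \<in> hom V \<I>\<^bsub>V\<^esub> (H a b)"
    show "name (uncurry a b k \<cdot>\<^bsub>A\<^esub> inv_arr A (\<lambda>\<lambda> a)) = k"
      using objs uncurry_hom[OF objs k] name_hom[OF inv[OF k]] uncurry_name[OF inv[OF k]] k
      by (intro uncurry_inject[of a b _ "\<I>\<^bsub>V\<^esub>"]) (simp_all add: hom_iff)
  qed
qed

text \<open>The tags recording source and target glue the bijections of \<open>name_bij\<close>, one
  for each pair of objects, into one on all arrows.\<close>

lemma underlying_arrow_bij:
  "bij_betw (\<lambda>f. (Dom A f, Cod A f, name f)) (Arr A) (Arr (underlying_category V E))"
proof (rule bij_betw_imageI)
  show "inj_on (\<lambda>f. (Dom A f, Cod A f, name f)) (Arr A)"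
  proof (rule inj_onI)
    fix f g assume fg: "f \<in> Arr A" "g \<in> Arr A"
      "(Dom A f, Cod A f, name f) = (Dom A g, Cod A g, name g)"
    then have "f \<in> hom A (Dom A f) (Cod A f)" "g \<in> hom A (Dom A f) (Cod A f)"
      by (simp_all add: hom_iff)
    then show "f = g"
      using fg name_bij[of "Dom A f" "Cod A f"] by (auto simp: bij_betw_def inj_on_def)
  qed
  show "(\<lambda>f. (Dom A f, Cod A f, name f)) ` Arr A = Arr (underlying_category V E)"
  proof (intro equalityI subsetI)
    fix t assume "t \<in> (\<lambda>f. (Dom A f, Cod A f, name f)) ` Arr A"
    then show "t \<in> Arr (underlying_category V E)"
      by (auto simp: underlying_category_def hom_iff)
  next
    fix t assume "t \<in> Arr (underlying_category V E)"
    then obtain a b k where t: "t = (a, b, k)" "a \<in> Obj A" "b \<in> Obj A" "k \<in> hom V \<I>\<^bsub>V\<^esub> (H a b)"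
      by (auto simp: underlying_category_def)
    then obtain f where "f \<in> hom A a b" "k = name f"
      using name_bij[of a b] by (auto simp: bij_betw_def)
    then show "t \<in> (\<lambda>f. (Dom A f, Cod A f, name f)) ` Arr A"
      using t by (auto simp: hom_iff)
  qed
qed

end


section \<open>The monoidal structure induced by an opmonoidal action\<close>

locale closed_opmonoidal_action =
  closed_action V A act R + opmonoidal_action V A act op
  for V :: "('v, 'm, 'x) braided_data_scheme"
    and A :: "('o, 'n, 'y) monoidal_data_scheme"
    and act :: "('v, 'm, 'o, 'n) action_data" (structure)
    and R :: "'o \<Rightarrow> ('v, 'm, 'o, 'n) right_adjoint_data"
    and op :: "('v, 'o, 'n) opmonoidal_data" (structure)
begin

section \<open>The tensor \<open>V\<close>-functor\<close>

abbreviation S :: "('o, 'm) Vmonoidal_data" where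
  "S \<equiv> induced_monoidal V A act R op"

abbreviation T :: "'o \<Rightarrow> 'o \<Rightarrow> 'o \<Rightarrow> 'o \<Rightarrow> 'm" where
  "T a b c d \<equiv> VonHom (VTens S) (a, b) (c, d)"

lemma Arr_Xi [simp]:
  assumes "X \<in> Obj V" "Y \<in> Obj V" "a \<in> Obj A" "b \<in> Obj A"
  shows "\<xi>\<^bsub>op\<^esub> X Y a b \<in> Arr A"
    "Dom A (\<xi>\<^bsub>op\<^esub> X Y a b) = (X \<otimes>\<^bsub>V\<^esub> Y) \<star> (a \<otimes>\<^bsub>A\<^esub> b)"
    "Cod A (\<xi>\<^bsub>op\<^esub> X Y a b) = (X \<star> a) \<otimes>\<^bsub>A\<^esub> (Y \<star> b)"
  using Xi_hom[OF assms] by (simp_all add: hom_iff)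

lemma Arr_interchange [simp]:
  assumes "w \<in> Obj V" "x \<in> Obj V" "y \<in> Obj V" "z \<in> Obj V"
  shows "interchange V w x y z \<in> Arr V"
    "Dom V (interchange V w x y z) = (w \<otimes>\<^bsub>V\<^esub> x) \<otimes>\<^bsub>V\<^esub> (y \<otimes>\<^bsub>V\<^esub> z)"
    "Cod V (interchange V w x y z) = (w \<otimes>\<^bsub>V\<^esub> y) \<otimes>\<^bsub>V\<^esub> (x \<otimes>\<^bsub>V\<^esub> z)"
  using base.interchange_hom[OF assms] by (simp_all add: hom_iff)

lemma induced_simps [simp]:
  "VonObj (VTens S) (a, b) = a \<otimes>\<^bsub>A\<^esub> b" "VUnit S = \<I>\<^bsub>A\<^esub>"
  "VAssoc S a b c = name (\<a>\<^bsub>A\<^esub> a b c)" "VLUnit S a = name (\<l>\<^bsub>A\<^esub> a)" "VRUnit S a = name (\<r>\<^bsub>A\<^esub> a)"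
  by (simp_all add: induced_monoidal_def)

lemma T_props:
  assumes objs: "a \<in> Obj A" "b \<in> Obj A" "c \<in> Obj A" "d \<in> Obj A"
  shows T_hom: "T a b c d \<in> hom V (H a c \<otimes>\<^bsub>V\<^esub> H b d) (H (a \<otimes>\<^bsub>A\<^esub> b) (c \<otimes>\<^bsub>A\<^esub> d))"
    and uncurry_T: "uncurry (a \<otimes>\<^bsub>A\<^esub> b) (c \<otimes>\<^bsub>A\<^esub> d) (T a b c d)
      = (Counit (R a) c \<boxtimes>\<^bsub>A\<^esub> Counit (R b) d) \<cdot>\<^bsub>A\<^esub> \<xi>\<^bsub>op\<^esub> (H a c) (H b d) a b"
proof -
  have ab: "a \<otimes>\<^bsub>A\<^esub> b \<in> Obj A" "c \<otimes>\<^bsub>A\<^esub> d \<in> Obj A" "H a c \<otimes>\<^bsub>V\<^esub> H b d \<in> Obj V"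
    using objs by simp_all
  have "(Counit (R a) c \<boxtimes>\<^bsub>A\<^esub> Counit (R b) d) \<cdot>\<^bsub>A\<^esub> \<xi>\<^bsub>op\<^esub> (H a c) (H b d) a b
      \<in> hom A ((H a c \<otimes>\<^bsub>V\<^esub> H b d) \<star> (a \<otimes>\<^bsub>A\<^esub> b)) (c \<otimes>\<^bsub>A\<^esub> d)"
    using objs by (simp add: hom_iff)
  note * = ab this
  show "T a b c d \<in> hom V (H a c \<otimes>\<^bsub>V\<^esub> H b d) (H (a \<otimes>\<^bsub>A\<^esub> b) (c \<otimes>\<^bsub>A\<^esub> d))"
    and "uncurry (a \<otimes>\<^bsub>A\<^esub> b) (c \<otimes>\<^bsub>A\<^esub> d) (T a b c d)
      = (Counit (R a) c \<boxtimes>\<^bsub>A\<^esub> Counit (R b) d) \<cdot>\<^bsub>A\<^esub> \<xi>\<^bsub>op\<^esub> (H a c) (H b d) a b"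
    using transpose_hom[OF *] uncurry_transpose[OF *] by (simp_all add: induced_monoidal_def)
qed

lemma Arr_T [simp]:
  assumes "a \<in> Obj A" "b \<in> Obj A" "c \<in> Obj A" "d \<in> Obj A"
  shows "T a b c d \<in> Arr V" "Dom V (T a b c d) = H a c \<otimes>\<^bsub>V\<^esub> H b d"
    "Cod V (T a b c d) = H (a \<otimes>\<^bsub>A\<^esub> b) (c \<otimes>\<^bsub>A\<^esub> d)"
  using T_hom[OF assms] by (simp_all add: hom_iff)

lemma uncurry_T_TensA:
  assumes objs: "a \<in> Obj A" "b \<in> Obj A" "c \<in> Obj A" "d \<in> Obj A"
    and f: "f \<in> hom V X (H a c)" and g: "g \<in> hom V Y (H b d)"
  shows "uncurry (a \<otimes>\<^bsub>A\<^esub> b) (c \<otimes>\<^bsub>A\<^esub> d) (T a b c d \<cdot>\<^bsub>V\<^esub> (f \<boxtimes>\<^bsub>V\<^esub> g))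
    = (uncurry a c f \<boxtimes>\<^bsub>A\<^esub> uncurry b d g) \<cdot>\<^bsub>A\<^esub> \<xi>\<^bsub>op\<^esub> X Y a b"
proof -
  have X: "X \<in> Obj V" "Y \<in> Obj V"
    using f g by (auto simp: hom_iff)
  note facts = objs X f[unfolded hom_iff] g[unfolded hom_iff]
  have i: "\<i>\<^bsub>A\<^esub> a \<in> hom A a a" "\<i>\<^bsub>A\<^esub> b \<in> hom A b b"
    using objs by (simp_all add: hom_iff)
  \<comment> \<open>The identity of the tensor of \<open>a\<close> and \<open>b\<close> is kept as a
    tensor of identities so that naturality of \<open>\<xi>\<close> moves \<open>f\<close> and
    \<open>g\<close> to its other side.\<close>
  have "uncurry (a \<otimes>\<^bsub>A\<^esub> b) (c \<otimes>\<^bsub>A\<^esub> d) (T a b c d \<cdot>\<^bsub>V\<^esub> (f \<boxtimes>\<^bsub>V\<^esub> g))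
      = (Counit (R a) c \<boxtimes>\<^bsub>A\<^esub> Counit (R b) d) \<cdot>\<^bsub>A\<^esub> \<xi>\<^bsub>op\<^esub> (H a c) (H b d) a b
        \<cdot>\<^bsub>A\<^esub> ((f \<boxtimes>\<^bsub>V\<^esub> g) \<odot> (\<i>\<^bsub>A\<^esub> a \<boxtimes>\<^bsub>A\<^esub> \<i>\<^bsub>A\<^esub> b))"
    using facts
    by (subst uncurry_Comp[where X = "H a c \<otimes>\<^bsub>V\<^esub> H b d" and Y = "X \<otimes>\<^bsub>V\<^esub> Y"])
      (simp_all add: hom_iff uncurry_T)
  also have "\<dots> = (Counit (R a) c \<boxtimes>\<^bsub>A\<^esub> Counit (R b) d)
        \<cdot>\<^bsub>A\<^esub> ((f \<odot> \<i>\<^bsub>A\<^esub> a) \<boxtimes>\<^bsub>A\<^esub> (g \<odot> \<i>\<^bsub>A\<^esub> b)) \<cdot>\<^bsub>A\<^esub> \<xi>\<^bsub>op\<^esub> X Y a b"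
    by (simp only: Xi_natural[OF f g i])
  also have "\<dots> = ((Counit (R a) c \<boxtimes>\<^bsub>A\<^esub> Counit (R b) d)
        \<cdot>\<^bsub>A\<^esub> ((f \<odot> \<i>\<^bsub>A\<^esub> a) \<boxtimes>\<^bsub>A\<^esub> (g \<odot> \<i>\<^bsub>A\<^esub> b))) \<cdot>\<^bsub>A\<^esub> \<xi>\<^bsub>op\<^esub> X Y a b"
    using facts by simp
  also have "\<dots> = (uncurry a c f \<boxtimes>\<^bsub>A\<^esub> uncurry b d g) \<cdot>\<^bsub>A\<^esub> \<xi>\<^bsub>op\<^esub> X Y a b"
    using facts by (simp add: acted.TensA_Comp uncurry_def)
  finally show ?thesis .
qed

text \<open>Opmonoidality of \<open>\<alpha>\<close> trades the \<open>interchange\<close> from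
  composition in the tensor square for two copies of \<open>\<xi>\<close>. The copies of
  \<open>\<alpha>\<close> it produces cancel the inverses inside the two composites, and naturality
  of \<open>\<xi>\<close> distributes the counits over the two tensor maps.\<close>

lemma T_VComp:
  assumes objs: "a \<in> Obj A" "b \<in> Obj A" "c \<in> Obj A" and objs': "a' \<in> Obj A" "b' \<in> Obj A" "c' \<in> Obj A"
  shows "T a a' c c' \<cdot>\<^bsub>V\<^esub> (VComp E a b c \<boxtimes>\<^bsub>V\<^esub> VComp E a' b' c')
      \<cdot>\<^bsub>V\<^esub> interchange V (H b c) (H b' c') (H a b) (H a' b')
    = VComp E (a \<otimes>\<^bsub>A\<^esub> a') (b \<otimes>\<^bsub>A\<^esub> b') (c \<otimes>\<^bsub>A\<^esub> c') \<cdot>\<^bsub>V\<^esub> (T b b' c c' \<boxtimes>\<^bsub>V\<^esub> T a a' b b')"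
    (is "?l = ?r")
proof (rule uncurry_inject)
  let ?X = "H b c" and ?X' = "H b' c'" and ?Y = "H a b" and ?Y' = "H a' b'"
  let ?a = "a \<otimes>\<^bsub>A\<^esub> a'" and ?b = "b \<otimes>\<^bsub>A\<^esub> b'" and ?c = "c \<otimes>\<^bsub>A\<^esub> c'"
  let ?e = "\<alpha> (?X \<otimes>\<^bsub>V\<^esub> ?X') (?Y \<otimes>\<^bsub>V\<^esub> ?Y') ?a"
  let ?\<epsilon> = "\<lambda>a b. Counit (R a) b"
  show "?a \<in> Obj A" "?c \<in> Obj A"
    using objs objs' by simp_all
  show "?l \<in> hom V ((?X \<otimes>\<^bsub>V\<^esub> ?X') \<otimes>\<^bsub>V\<^esub> (?Y \<otimes>\<^bsub>V\<^esub> ?Y')) (H ?a ?c)"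
    "?r \<in> hom V ((?X \<otimes>\<^bsub>V\<^esub> ?X') \<otimes>\<^bsub>V\<^esub> (?Y \<otimes>\<^bsub>V\<^esub> ?Y')) (H ?a ?c)"
    using objs objs' by (simp_all add: hom_iff)
  note homs = uncurry_hom[OF \<open>?a \<in> Obj A\<close> \<open>?c \<in> Obj A\<close> this(1)]
    uncurry_hom[OF \<open>?a \<in> Obj A\<close> \<open>?c \<in> Obj A\<close> this(2)]
  have M: "uncurry a c (VComp E a b c) \<in> hom A ((?X \<otimes>\<^bsub>V\<^esub> ?Y) \<star> a) c"
    "uncurry a' c' (VComp E a' b' c') \<in> hom A ((?X' \<otimes>\<^bsub>V\<^esub> ?Y') \<star> a') c'"
    using objs objs' by (auto intro!: uncurry_hom VComp_enriched_hom)
  have i: "\<i>\<^bsub>V\<^esub> ?X \<in> hom V ?X ?X" "\<i>\<^bsub>V\<^esub> ?X' \<in> hom V ?X' ?X'"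
    and \<epsilon>: "?\<epsilon> a b \<in> hom A (?Y \<star> a) b" "?\<epsilon> a' b' \<in> hom A (?Y' \<star> a') b'"
    using objs objs' by (simp_all add: hom_iff)
  show "uncurry ?a ?c ?l = uncurry ?a ?c ?r"
  \<comment> \<open>Precomposing \<open>?e\<close> completes the right-hand side of
    \<open>ActAssoc_opmonoidal\<close> on the left, and on the right cancels the inverse of
    \<open>\<alpha>\<close> in the outer composition.\<close>
  proof (rule acted.iso_epi[where e = ?e])
    have "uncurry ?a ?c ?l
        = uncurry ?a ?c (T a a' c c' \<cdot>\<^bsub>V\<^esub> (VComp E a b c \<boxtimes>\<^bsub>V\<^esub> VComp E a' b' c'))
          \<cdot>\<^bsub>A\<^esub> (interchange V ?X ?X' ?Y ?Y' \<odot> \<i>\<^bsub>A\<^esub> ?a)"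
      using objs objs'
      by (subst uncurry_Comp[symmetric]) (auto simp: hom_iff)
    also have "\<dots> = ((uncurry a c (VComp E a b c) \<boxtimes>\<^bsub>A\<^esub> uncurry a' c' (VComp E a' b' c'))
          \<cdot>\<^bsub>A\<^esub> \<xi>\<^bsub>op\<^esub> (?X \<otimes>\<^bsub>V\<^esub> ?Y) (?X' \<otimes>\<^bsub>V\<^esub> ?Y') a a') \<cdot>\<^bsub>A\<^esub> (interchange V ?X ?X' ?Y ?Y' \<odot> \<i>\<^bsub>A\<^esub> ?a)"
      using objs objs'
      by (subst uncurry_T_TensA[OF _ _ _ _ VComp_enriched_hom VComp_enriched_hom]) simp_all
    finally have "uncurry ?a ?c ?l \<cdot>\<^bsub>A\<^esub> ?e
        = (uncurry a c (VComp E a b c) \<boxtimes>\<^bsub>A\<^esub> uncurry a' c' (VComp E a' b' c'))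
          \<cdot>\<^bsub>A\<^esub> (\<xi>\<^bsub>op\<^esub> (?X \<otimes>\<^bsub>V\<^esub> ?Y) (?X' \<otimes>\<^bsub>V\<^esub> ?Y') a a'
            \<cdot>\<^bsub>A\<^esub> (interchange V ?X ?X' ?Y ?Y' \<odot> \<i>\<^bsub>A\<^esub> ?a) \<cdot>\<^bsub>A\<^esub> ?e)"
      using objs objs' M by (simp add: hom_iff)
    also have "\<dots> = (uncurry a c (VComp E a b c) \<boxtimes>\<^bsub>A\<^esub> uncurry a' c' (VComp E a' b' c'))
          \<cdot>\<^bsub>A\<^esub> ((\<alpha> ?X ?Y a \<boxtimes>\<^bsub>A\<^esub> \<alpha> ?X' ?Y' a') \<cdot>\<^bsub>A\<^esub> \<xi>\<^bsub>op\<^esub> ?X ?X' (?Y \<star> a) (?Y' \<star> a')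
            \<cdot>\<^bsub>A\<^esub> (\<i>\<^bsub>V\<^esub> (?X \<otimes>\<^bsub>V\<^esub> ?X') \<odot> \<xi>\<^bsub>op\<^esub> ?Y ?Y' a a'))"
      using objs objs' by (subst ActAssoc_opmonoidal) simp_all
    also have "\<dots> = ((uncurry a c (VComp E a b c) \<boxtimes>\<^bsub>A\<^esub> uncurry a' c' (VComp E a' b' c'))
          \<cdot>\<^bsub>A\<^esub> (\<alpha> ?X ?Y a \<boxtimes>\<^bsub>A\<^esub> \<alpha> ?X' ?Y' a')) \<cdot>\<^bsub>A\<^esub> \<xi>\<^bsub>op\<^esub> ?X ?X' (?Y \<star> a) (?Y' \<star> a')
            \<cdot>\<^bsub>A\<^esub> (\<i>\<^bsub>V\<^esub> (?X \<otimes>\<^bsub>V\<^esub> ?X') \<odot> \<xi>\<^bsub>op\<^esub> ?Y ?Y' a a')"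
      using objs objs' M by (simp add: hom_iff)
    \<comment> \<open>Each transposed composite ends in an inverse of \<open>\<alpha>\<close>, so
      tensoring with the two copies of \<open>\<alpha>\<close> leaves only counits.\<close>
    also have "(uncurry a c (VComp E a b c) \<boxtimes>\<^bsub>A\<^esub> uncurry a' c' (VComp E a' b' c'))
          \<cdot>\<^bsub>A\<^esub> (\<alpha> ?X ?Y a \<boxtimes>\<^bsub>A\<^esub> \<alpha> ?X' ?Y' a')
        = (?\<epsilon> b c \<cdot>\<^bsub>A\<^esub> (\<i>\<^bsub>V\<^esub> ?X \<odot> ?\<epsilon> a b)) \<boxtimes>\<^bsub>A\<^esub> (?\<epsilon> b' c' \<cdot>\<^bsub>A\<^esub> (\<i>\<^bsub>V\<^esub> ?X' \<odot> ?\<epsilon> a' b'))"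
      using objs objs' by (simp add: uncurry_VComp acted.TensA_Comp)
    also have "\<dots> \<cdot>\<^bsub>A\<^esub> \<xi>\<^bsub>op\<^esub> ?X ?X' (?Y \<star> a) (?Y' \<star> a') \<cdot>\<^bsub>A\<^esub> (\<i>\<^bsub>V\<^esub> (?X \<otimes>\<^bsub>V\<^esub> ?X') \<odot> \<xi>\<^bsub>op\<^esub> ?Y ?Y' a a')
        = (?\<epsilon> b c \<boxtimes>\<^bsub>A\<^esub> ?\<epsilon> b' c') \<cdot>\<^bsub>A\<^esub> (((\<i>\<^bsub>V\<^esub> ?X \<odot> ?\<epsilon> a b) \<boxtimes>\<^bsub>A\<^esub> (\<i>\<^bsub>V\<^esub> ?X' \<odot> ?\<epsilon> a' b'))
          \<cdot>\<^bsub>A\<^esub> \<xi>\<^bsub>op\<^esub> ?X ?X' (?Y \<star> a) (?Y' \<star> a')) \<cdot>\<^bsub>A\<^esub> (\<i>\<^bsub>V\<^esub> (?X \<otimes>\<^bsub>V\<^esub> ?X') \<odot> \<xi>\<^bsub>op\<^esub> ?Y ?Y' a a')"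
      using objs objs' by (simp flip: acted.TensA_Comp)
    also have "\<dots> = ((?\<epsilon> b c \<boxtimes>\<^bsub>A\<^esub> ?\<epsilon> b' c') \<cdot>\<^bsub>A\<^esub> \<xi>\<^bsub>op\<^esub> ?X ?X' b b')
          \<cdot>\<^bsub>A\<^esub> (((\<i>\<^bsub>V\<^esub> ?X \<boxtimes>\<^bsub>V\<^esub> \<i>\<^bsub>V\<^esub> ?X') \<odot> (?\<epsilon> a b \<boxtimes>\<^bsub>A\<^esub> ?\<epsilon> a' b'))
          \<cdot>\<^bsub>A\<^esub> (\<i>\<^bsub>V\<^esub> (?X \<otimes>\<^bsub>V\<^esub> ?X') \<odot> \<xi>\<^bsub>op\<^esub> ?Y ?Y' a a'))"
      unfolding Xi_natural[OF i \<epsilon>, symmetric] using objs objs' by simp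
    also have "\<dots> = uncurry ?b ?c (T b b' c c') \<cdot>\<^bsub>A\<^esub> (\<i>\<^bsub>V\<^esub> (?X \<otimes>\<^bsub>V\<^esub> ?X') \<odot> uncurry ?a ?b (T a a' b b'))"
      using objs objs' by (simp add: uncurry_T ActA_Comp)
    also have "\<dots> = uncurry ?a ?c ?r \<cdot>\<^bsub>A\<^esub> ?e"
      using objs objs'
      by (subst uncurry_VComp_TensA[OF _ _ _ T_hom T_hom]) (simp_all add: uncurry_T)
    finally show "uncurry ?a ?c ?l \<cdot>\<^bsub>A\<^esub> ?e = uncurry ?a ?c ?r \<cdot>\<^bsub>A\<^esub> ?e" .
  qed (use objs objs' homs in \<open>simp_all add: hom_iff\<close>)
qed

text \<open>Opmonoidality of \<open>\<lambda>\<lambda>\<close> rewrites the two unit constraints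
  after \<open>\<xi>\<close> as one unit constraint after \<open>\<l>\<close> at \<open>I\<close>,
  which cancels the inserted inverse. Besides identifying the tensor of underlying arrows, this
  gives preservation of identities by \<open>T\<close>, since identities are names.\<close>

lemma T_name:
  assumes f: "f \<in> hom A a c" and g: "g \<in> hom A b d"
  shows "T a b c d \<cdot>\<^bsub>V\<^esub> (name f \<boxtimes>\<^bsub>V\<^esub> name g) \<cdot>\<^bsub>V\<^esub> inv_arr V (\<l>\<^bsub>V\<^esub> \<I>\<^bsub>V\<^esub>) = name (f \<boxtimes>\<^bsub>A\<^esub> g)"
    (is "?l = ?r")
proof (rule uncurry_inject)
  have objs: "a \<in> Obj A" "b \<in> Obj A" "c \<in> Obj A" "d \<in> Obj A"
    using f g by (auto simp: hom_iff)
  show "a \<otimes>\<^bsub>A\<^esub> b \<in> Obj A" "c \<otimes>\<^bsub>A\<^esub> d \<in> Obj A"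
    using objs by simp_all
  note facts = objs f[unfolded hom_iff] g[unfolded hom_iff]
  have fg: "f \<boxtimes>\<^bsub>A\<^esub> g \<in> hom A (a \<otimes>\<^bsub>A\<^esub> b) (c \<otimes>\<^bsub>A\<^esub> d)"
    using facts by (simp add: hom_iff)
  show "?l \<in> hom V \<I>\<^bsub>V\<^esub> (H (a \<otimes>\<^bsub>A\<^esub> b) (c \<otimes>\<^bsub>A\<^esub> d))"
    "?r \<in> hom V \<I>\<^bsub>V\<^esub> (H (a \<otimes>\<^bsub>A\<^esub> b) (c \<otimes>\<^bsub>A\<^esub> d))"
    using facts by (auto simp: hom_iff)
  have "uncurry (a \<otimes>\<^bsub>A\<^esub> b) (c \<otimes>\<^bsub>A\<^esub> d) ?l
      = uncurry (a \<otimes>\<^bsub>A\<^esub> b) (c \<otimes>\<^bsub>A\<^esub> d) (T a b c d \<cdot>\<^bsub>V\<^esub> (name f \<boxtimes>\<^bsub>V\<^esub> name g))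
        \<cdot>\<^bsub>A\<^esub> (inv_arr V (\<l>\<^bsub>V\<^esub> \<I>\<^bsub>V\<^esub>) \<odot> \<i>\<^bsub>A\<^esub> (a \<otimes>\<^bsub>A\<^esub> b))"
    using facts by (subst uncurry_Comp[symmetric]) (auto simp: hom_iff)
  also have "\<dots> = (((f \<cdot>\<^bsub>A\<^esub> \<lambda>\<lambda> a) \<boxtimes>\<^bsub>A\<^esub> (g \<cdot>\<^bsub>A\<^esub> \<lambda>\<lambda> b)) \<cdot>\<^bsub>A\<^esub> \<xi>\<^bsub>op\<^esub> \<I>\<^bsub>V\<^esub> \<I>\<^bsub>V\<^esub> a b)
        \<cdot>\<^bsub>A\<^esub> (inv_arr V (\<l>\<^bsub>V\<^esub> \<I>\<^bsub>V\<^esub>) \<odot> \<i>\<^bsub>A\<^esub> (a \<otimes>\<^bsub>A\<^esub> b))"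
    using uncurry_T_TensA[OF objs name_hom[OF f] name_hom[OF g]]
    by (simp add: uncurry_name[OF f] uncurry_name[OF g])
  also have "\<dots> = (f \<boxtimes>\<^bsub>A\<^esub> g) \<cdot>\<^bsub>A\<^esub> ((\<lambda>\<lambda> a \<boxtimes>\<^bsub>A\<^esub> \<lambda>\<lambda> b) \<cdot>\<^bsub>A\<^esub> \<xi>\<^bsub>op\<^esub> \<I>\<^bsub>V\<^esub> \<I>\<^bsub>V\<^esub> a b)
        \<cdot>\<^bsub>A\<^esub> (inv_arr V (\<l>\<^bsub>V\<^esub> \<I>\<^bsub>V\<^esub>) \<odot> \<i>\<^bsub>A\<^esub> (a \<otimes>\<^bsub>A\<^esub> b))"
    using facts by (simp flip: acted.TensA_Comp)
  also have "\<dots> = (f \<boxtimes>\<^bsub>A\<^esub> g) \<cdot>\<^bsub>A\<^esub> \<lambda>\<lambda> (a \<otimes>\<^bsub>A\<^esub> b)"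
    unfolding ActUnit_opmonoidal[OF objs(1,2)] using facts by (simp add: ActA_Comp)
  also have "\<dots> = uncurry (a \<otimes>\<^bsub>A\<^esub> b) (c \<otimes>\<^bsub>A\<^esub> d) ?r"
    by (simp only: uncurry_name[OF fg])
  finally show "uncurry (a \<otimes>\<^bsub>A\<^esub> b) (c \<otimes>\<^bsub>A\<^esub> d) ?l = uncurry (a \<otimes>\<^bsub>A\<^esub> b) (c \<otimes>\<^bsub>A\<^esub> d) ?r" .
qed

lemma VTens_V_functor: "V_functor V (Vtensor_category V E E) E (VTens S)"
proof -
  have "T a b a b \<cdot>\<^bsub>V\<^esub> (VIde E a \<boxtimes>\<^bsub>V\<^esub> VIde E b) \<cdot>\<^bsub>V\<^esub> inv_arr V (\<l>\<^bsub>V\<^esub> \<I>\<^bsub>V\<^esub>) = VIde E (a \<otimes>\<^bsub>A\<^esub> b)"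
    if "a \<in> Obj A" "b \<in> Obj A" for a b
    using T_name[of "\<i>\<^bsub>A\<^esub> a" a a "\<i>\<^bsub>A\<^esub> b" b b] that by (simp add: hom_iff name_Ide)
  then show ?thesis
    by (auto simp: V_functor_def Vtensor_category_def T_VComp T_hom)
qed

text \<open>Transposing both naturality squares turns \<open>V\<close>-naturality of a family of named arrows into
  an equation in \<open>A\<close>.\<close>

lemma V_nat_iso_name:
  assumes objs: "\<And>x. x \<in> VObj B \<Longrightarrow> VonObj F x \<in> Obj A" "\<And>x. x \<in> VObj B \<Longrightarrow> VonObj G x \<in> Obj A"
    and F: "\<And>x y. \<lbrakk>x \<in> VObj B; y \<in> VObj B\<rbrakk>
      \<Longrightarrow> VonHom F x y \<in> hom V (VHom B x y) (H (VonObj F x) (VonObj F y))"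
    and G: "\<And>x y. \<lbrakk>x \<in> VObj B; y \<in> VObj B\<rbrakk>
      \<Longrightarrow> VonHom G x y \<in> hom V (VHom B x y) (H (VonObj G x) (VonObj G y))"
    and \<sigma>: "\<And>x. x \<in> VObj B \<Longrightarrow> \<sigma> x \<in> hom A (VonObj F x) (VonObj G x)"
    and \<sigma>_iso: "\<And>x. x \<in> VObj B \<Longrightarrow> iso (underlying_category V E) (VonObj F x, VonObj G x, name (\<sigma> x))"
    and natural: "\<And>x y. \<lbrakk>x \<in> VObj B; y \<in> VObj B\<rbrakk>
      \<Longrightarrow> \<sigma> y \<cdot>\<^bsub>A\<^esub> uncurry (VonObj F x) (VonObj F y) (VonHom F x y)
        = uncurry (VonObj G x) (VonObj G y) (VonHom G x y) \<cdot>\<^bsub>A\<^esub> (\<i>\<^bsub>V\<^esub> (VHom B x y) \<odot> \<sigma> x)"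
    and \<tau>: "\<And>x. x \<in> VObj B \<Longrightarrow> \<tau> x = name (\<sigma> x)"
  shows "V_nat_iso V B E F G \<tau>"
proof -
  have "VComp E (VonObj F x) (VonObj F y) (VonObj G y)
        \<cdot>\<^bsub>V\<^esub> (name (\<sigma> y) \<boxtimes>\<^bsub>V\<^esub> VonHom F x y) \<cdot>\<^bsub>V\<^esub> inv_arr V (\<l>\<^bsub>V\<^esub> (VHom B x y))
      = VComp E (VonObj F x) (VonObj G x) (VonObj G y)
        \<cdot>\<^bsub>V\<^esub> (VonHom G x y \<boxtimes>\<^bsub>V\<^esub> name (\<sigma> x)) \<cdot>\<^bsub>V\<^esub> inv_arr V (\<r>\<^bsub>V\<^esub> (VHom B x y))" (is "?l = ?r")
    if x: "x \<in> VObj B" and y: "y \<in> VObj B" for x y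
  proof (rule uncurry_inject)
    note facts = objs[OF x] objs[OF y] F[OF x y, unfolded hom_iff] G[OF x y, unfolded hom_iff]
      \<sigma>[OF x, unfolded hom_iff] \<sigma>[OF y, unfolded hom_iff]
    have X: "VHom B x y \<in> Obj V"
      using base.Dom_Obj F[OF x y] unfolding hom_iff by metis
    show "VonObj F x \<in> Obj A" "VonObj G y \<in> Obj A"
      by (fact objs(1)[OF x], fact objs(2)[OF y])
    show "?l \<in> hom V (VHom B x y) (H (VonObj F x) (VonObj G y))"
      "?r \<in> hom V (VHom B x y) (H (VonObj F x) (VonObj G y))"
      using facts X by (simp_all add: hom_iff)
    show "uncurry (VonObj F x) (VonObj G y) ?l = uncurry (VonObj F x) (VonObj G y) ?r"
      using uncurry_name_VComp[OF \<sigma>[OF y] objs(1)[OF x] F[OF x y]]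
        uncurry_VComp_name[OF G[OF x y] objs(2)[OF y] \<sigma>[OF x]] natural[OF x y]
      by simp
  qed
  then show ?thesis
    using \<sigma>_iso name_hom[OF \<sigma>] by (simp add: V_nat_iso_def \<tau>)
qed

section \<open>The underlying monoidal category and the constraints\<close>

lemma underlying_monoidal_simps [simp]:
  "Obj (underlying_monoidal V E S) = Obj A"
  "Arr (underlying_monoidal V E S) = Arr (underlying_category V E)"
  "Dom (underlying_monoidal V E S) = Dom (underlying_category V E)"
  "Cod (underlying_monoidal V E S) = Cod (underlying_category V E)"
  "Ide (underlying_monoidal V E S) = Ide (underlying_category V E)"
  "Comp (underlying_monoidal V E S) = Comp (underlying_category V E)"
  by (simp_all add: underlying_monoidal_def underlying_category_def Let_def
      monoidal_data.defs category_data.defs)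

text \<open>The comparison is the identity on objects. Identities, composites and tensors match by
  \<open>name_Ide\<close>, \<open>name_Comp\<close> and \<open>T_name\<close>; the constraints match
  because they were defined as names.\<close>

sublocale transport: monoidal_transport A "underlying_monoidal V E S"
  "\<lambda>a. a" "\<lambda>f. (Dom A f, Cod A f, name f)"
proof
  show "bij_betw (\<lambda>f. (Dom A f, Cod A f, name f)) (Arr A) (Arr (underlying_monoidal V E S))"
    using underlying_arrow_bij by simp
  show "bij_betw (\<lambda>a. a) (Obj A) (Obj (underlying_monoidal V E S))"
    by (simp add: bij_betw_def)
qed (auto simp: underlying_monoidal_def Let_def monoidal_data.defs category_data.defs
      underlying_category_def name_Ide name_Comp T_name hom_iff)

text \<open>Invertibility refers only to the category fields, which
  \<open>underlying_monoidal\<close> shares with \<open>underlying_category\<close>, so the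
  transport along names applies.\<close>

lemma iso_name:
  assumes "iso A f" "Dom A f = a" "Cod A f = b"
  shows "iso (underlying_category V E) (a, b, name f)"
  using transport.iso_F[OF assms(1)] assms(2,3)
  by (simp add: iso_def inverse_arrows_def hom_def)

text \<open>The left side becomes a triple tensor of counits after two copies of
  \<open>\<xi>\<close>. Naturality of the associator of \<open>A\<close> moves it past the counits,
  and \<open>Xi_assoc\<close> rebrackets the copies of \<open>\<xi>\<close>, leaving the associators
  of \<open>V\<close> and \<open>A\<close> acting jointly.\<close>

lemma VAssoc_natural:
  assumes objs: "a \<in> Obj A" "b \<in> Obj A" "c \<in> Obj A" and objs': "a' \<in> Obj A" "b' \<in> Obj A" "c' \<in> Obj A"
  shows "\<a>\<^bsub>A\<^esub> a' b' c' \<cdot>\<^bsub>A\<^esub> uncurry ((a \<otimes>\<^bsub>A\<^esub> b) \<otimes>\<^bsub>A\<^esub> c) ((a' \<otimes>\<^bsub>A\<^esub> b') \<otimes>\<^bsub>A\<^esub> c')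
        (T (a \<otimes>\<^bsub>A\<^esub> b) c (a' \<otimes>\<^bsub>A\<^esub> b') c' \<cdot>\<^bsub>V\<^esub> (T a b a' b' \<boxtimes>\<^bsub>V\<^esub> \<i>\<^bsub>V\<^esub> (H c c')))
    = uncurry (a \<otimes>\<^bsub>A\<^esub> b \<otimes>\<^bsub>A\<^esub> c) (a' \<otimes>\<^bsub>A\<^esub> b' \<otimes>\<^bsub>A\<^esub> c')
        (T a (b \<otimes>\<^bsub>A\<^esub> c) a' (b' \<otimes>\<^bsub>A\<^esub> c') \<cdot>\<^bsub>V\<^esub> (\<i>\<^bsub>V\<^esub> (H a a') \<boxtimes>\<^bsub>V\<^esub> T b c b' c')
          \<cdot>\<^bsub>V\<^esub> \<a>\<^bsub>V\<^esub> (H a a') (H b b') (H c c'))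
      \<cdot>\<^bsub>A\<^esub> (\<i>\<^bsub>V\<^esub> ((H a a' \<otimes>\<^bsub>V\<^esub> H b b') \<otimes>\<^bsub>V\<^esub> H c c') \<odot> \<a>\<^bsub>A\<^esub> a b c)"
    (is "_ \<cdot>\<^bsub>A\<^esub> uncurry ?s ?t ?l = uncurry ?s' ?t' ?r \<cdot>\<^bsub>A\<^esub> _")
proof -
  let ?P = "H a a'" and ?Q = "H b b'" and ?S = "H c c'"
  let ?\<epsilon>a = "Counit (R a) a'" and ?\<epsilon>b = "Counit (R b) b'" and ?\<epsilon>c = "Counit (R c) c'"
  have i: "\<i>\<^bsub>V\<^esub> ?P \<in> hom V ?P ?P" "\<i>\<^bsub>V\<^esub> ?S \<in> hom V ?S ?S"
    and \<epsilon>: "?\<epsilon>a \<in> hom A (?P \<star> a) a'" "?\<epsilon>b \<in> hom A (?Q \<star> b) b'" "?\<epsilon>c \<in> hom A (?S \<star> c) c'"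
    using objs objs' by (simp_all add: hom_iff)
  have "uncurry ?s ?t ?l
      = (((?\<epsilon>a \<boxtimes>\<^bsub>A\<^esub> ?\<epsilon>b) \<cdot>\<^bsub>A\<^esub> \<xi>\<^bsub>op\<^esub> ?P ?Q a b) \<boxtimes>\<^bsub>A\<^esub> (?\<epsilon>c \<cdot>\<^bsub>A\<^esub> \<i>\<^bsub>A\<^esub> (?S \<star> c)))
        \<cdot>\<^bsub>A\<^esub> \<xi>\<^bsub>op\<^esub> (?P \<otimes>\<^bsub>V\<^esub> ?Q) ?S (a \<otimes>\<^bsub>A\<^esub> b) c"
    using objs objs'
    by (subst uncurry_T_TensA[OF _ _ _ _ T_hom i(2)]) (simp_all add: uncurry_T uncurry_Ide)
  also have "\<dots> = ((?\<epsilon>a \<boxtimes>\<^bsub>A\<^esub> ?\<epsilon>b) \<boxtimes>\<^bsub>A\<^esub> ?\<epsilon>c) \<cdot>\<^bsub>A\<^esub> (\<xi>\<^bsub>op\<^esub> ?P ?Q a b \<boxtimes>\<^bsub>A\<^esub> \<i>\<^bsub>A\<^esub> (?S \<star> c))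
        \<cdot>\<^bsub>A\<^esub> \<xi>\<^bsub>op\<^esub> (?P \<otimes>\<^bsub>V\<^esub> ?Q) ?S (a \<otimes>\<^bsub>A\<^esub> b) c"
    \<comment> \<open>Keeping \<open>?\<epsilon>c\<close> composed with an identity makes both
      tensor factors composites, which the flipped interchange law can split.\<close>
    using objs objs' by (simp del: acted.Comp_Ide_Dom flip: acted.TensA_Comp)
  finally have "\<a>\<^bsub>A\<^esub> a' b' c' \<cdot>\<^bsub>A\<^esub> uncurry ?s ?t ?l
      = (\<a>\<^bsub>A\<^esub> a' b' c' \<cdot>\<^bsub>A\<^esub> ((?\<epsilon>a \<boxtimes>\<^bsub>A\<^esub> ?\<epsilon>b) \<boxtimes>\<^bsub>A\<^esub> ?\<epsilon>c))
        \<cdot>\<^bsub>A\<^esub> (\<xi>\<^bsub>op\<^esub> ?P ?Q a b \<boxtimes>\<^bsub>A\<^esub> \<i>\<^bsub>A\<^esub> (?S \<star> c)) \<cdot>\<^bsub>A\<^esub> \<xi>\<^bsub>op\<^esub> (?P \<otimes>\<^bsub>V\<^esub> ?Q) ?S (a \<otimes>\<^bsub>A\<^esub> b) c"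
    using objs objs' by simp
  also have "\<dots> = (?\<epsilon>a \<boxtimes>\<^bsub>A\<^esub> (?\<epsilon>b \<boxtimes>\<^bsub>A\<^esub> ?\<epsilon>c)) \<cdot>\<^bsub>A\<^esub> (\<a>\<^bsub>A\<^esub> (?P \<star> a) (?Q \<star> b) (?S \<star> c)
        \<cdot>\<^bsub>A\<^esub> (\<xi>\<^bsub>op\<^esub> ?P ?Q a b \<boxtimes>\<^bsub>A\<^esub> \<i>\<^bsub>A\<^esub> (?S \<star> c)) \<cdot>\<^bsub>A\<^esub> \<xi>\<^bsub>op\<^esub> (?P \<otimes>\<^bsub>V\<^esub> ?Q) ?S (a \<otimes>\<^bsub>A\<^esub> b) c)"
    unfolding acted.Assoc_natural[OF \<epsilon>] using objs objs' by simp
  also have "\<dots> = (?\<epsilon>a \<boxtimes>\<^bsub>A\<^esub> (?\<epsilon>b \<boxtimes>\<^bsub>A\<^esub> ?\<epsilon>c)) \<cdot>\<^bsub>A\<^esub> (\<i>\<^bsub>A\<^esub> (?P \<star> a) \<boxtimes>\<^bsub>A\<^esub> \<xi>\<^bsub>op\<^esub> ?Q ?S b c)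
        \<cdot>\<^bsub>A\<^esub> \<xi>\<^bsub>op\<^esub> ?P (?Q \<otimes>\<^bsub>V\<^esub> ?S) a (b \<otimes>\<^bsub>A\<^esub> c) \<cdot>\<^bsub>A\<^esub> (\<a>\<^bsub>V\<^esub> ?P ?Q ?S \<odot> \<a>\<^bsub>A\<^esub> a b c)"
    using objs objs' by (subst Xi_assoc) simp_all
  also have "\<dots> = (((?\<epsilon>a \<boxtimes>\<^bsub>A\<^esub> (?\<epsilon>b \<boxtimes>\<^bsub>A\<^esub> ?\<epsilon>c)) \<cdot>\<^bsub>A\<^esub> (\<i>\<^bsub>A\<^esub> (?P \<star> a) \<boxtimes>\<^bsub>A\<^esub> \<xi>\<^bsub>op\<^esub> ?Q ?S b c))
        \<cdot>\<^bsub>A\<^esub> \<xi>\<^bsub>op\<^esub> ?P (?Q \<otimes>\<^bsub>V\<^esub> ?S) a (b \<otimes>\<^bsub>A\<^esub> c)) \<cdot>\<^bsub>A\<^esub> (\<a>\<^bsub>V\<^esub> ?P ?Q ?S \<odot> \<a>\<^bsub>A\<^esub> a b c)"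
    using objs objs' by simp
  also have "\<dots> = ((?\<epsilon>a \<boxtimes>\<^bsub>A\<^esub> ((?\<epsilon>b \<boxtimes>\<^bsub>A\<^esub> ?\<epsilon>c) \<cdot>\<^bsub>A\<^esub> \<xi>\<^bsub>op\<^esub> ?Q ?S b c))
        \<cdot>\<^bsub>A\<^esub> \<xi>\<^bsub>op\<^esub> ?P (?Q \<otimes>\<^bsub>V\<^esub> ?S) a (b \<otimes>\<^bsub>A\<^esub> c)) \<cdot>\<^bsub>A\<^esub> (\<a>\<^bsub>V\<^esub> ?P ?Q ?S \<odot> \<a>\<^bsub>A\<^esub> a b c)"
    using objs objs' by (simp add: acted.TensA_Comp)
  also have "\<dots> = uncurry ?s' ?t' (T a (b \<otimes>\<^bsub>A\<^esub> c) a' (b' \<otimes>\<^bsub>A\<^esub> c') \<cdot>\<^bsub>V\<^esub> (\<i>\<^bsub>V\<^esub> ?P \<boxtimes>\<^bsub>V\<^esub> T b c b' c'))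
        \<cdot>\<^bsub>A\<^esub> (\<a>\<^bsub>V\<^esub> ?P ?Q ?S \<odot> \<a>\<^bsub>A\<^esub> a b c)"
    using objs objs'
    by (subst uncurry_T_TensA[OF _ _ _ _ i(1) T_hom]) (simp_all add: uncurry_T uncurry_Ide)
  \<comment> \<open>The joint action of both associators is factored: the one of \<open>V\<close> is
    absorbed into the transposed arrow, and the one of \<open>A\<close> remains as the required
    right factor.\<close>
  also have "\<dots> = (uncurry ?s' ?t' (T a (b \<otimes>\<^bsub>A\<^esub> c) a' (b' \<otimes>\<^bsub>A\<^esub> c') \<cdot>\<^bsub>V\<^esub> (\<i>\<^bsub>V\<^esub> ?P \<boxtimes>\<^bsub>V\<^esub> T b c b' c'))
        \<cdot>\<^bsub>A\<^esub> (\<a>\<^bsub>V\<^esub> ?P ?Q ?S \<odot> \<i>\<^bsub>A\<^esub> ?s'))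
        \<cdot>\<^bsub>A\<^esub> (\<i>\<^bsub>V\<^esub> ((?P \<otimes>\<^bsub>V\<^esub> ?Q) \<otimes>\<^bsub>V\<^esub> ?S) \<odot> \<a>\<^bsub>A\<^esub> a b c)"
    using objs objs'
      uncurry_hom[of ?s' ?t' "T a (b \<otimes>\<^bsub>A\<^esub> c) a' (b' \<otimes>\<^bsub>A\<^esub> c') \<cdot>\<^bsub>V\<^esub> (\<i>\<^bsub>V\<^esub> ?P \<boxtimes>\<^bsub>V\<^esub> T b c b' c')" "?P \<otimes>\<^bsub>V\<^esub> ?Q \<otimes>\<^bsub>V\<^esub> ?S"]
    by (simp add: hom_iff ActA_Comp)
  also have "uncurry ?s' ?t' (T a (b \<otimes>\<^bsub>A\<^esub> c) a' (b' \<otimes>\<^bsub>A\<^esub> c') \<cdot>\<^bsub>V\<^esub> (\<i>\<^bsub>V\<^esub> ?P \<boxtimes>\<^bsub>V\<^esub> T b c b' c'))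
        \<cdot>\<^bsub>A\<^esub> (\<a>\<^bsub>V\<^esub> ?P ?Q ?S \<odot> \<i>\<^bsub>A\<^esub> ?s') = uncurry ?s' ?t' ?r"
    using objs objs' by (subst uncurry_Comp[symmetric]) (auto simp: hom_iff)
  finally show ?thesis .
qed

text \<open>The identity of the unit object transposes to \<open>\<lambda>\<lambda>\<close> at that
  object, which equals \<open>\<xi>0\<close>. The left unit axiom for \<open>\<xi>\<close> then
  applies once \<open>\<l>\<close> has been moved past the counit, and its factor from
  \<open>V\<close> cancels the inverse in the definition of the section functor.\<close>

lemma VLUnit_natural:
  assumes objs: "a \<in> Obj A" "b \<in> Obj A"
  shows "\<l>\<^bsub>A\<^esub> b \<cdot>\<^bsub>A\<^esub> uncurry (\<I>\<^bsub>A\<^esub> \<otimes>\<^bsub>A\<^esub> a) (\<I>\<^bsub>A\<^esub> \<otimes>\<^bsub>A\<^esub> b)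
        (T \<I>\<^bsub>A\<^esub> a \<I>\<^bsub>A\<^esub> b \<cdot>\<^bsub>V\<^esub> (VIde E \<I>\<^bsub>A\<^esub> \<boxtimes>\<^bsub>V\<^esub> \<i>\<^bsub>V\<^esub> (H a b)) \<cdot>\<^bsub>V\<^esub> inv_arr V (\<l>\<^bsub>V\<^esub> (H a b)))
    = Counit (R a) b \<cdot>\<^bsub>A\<^esub> (\<i>\<^bsub>V\<^esub> (H a b) \<odot> \<l>\<^bsub>A\<^esub> a)"
    (is "_ \<cdot>\<^bsub>A\<^esub> uncurry ?s ?t ?l = _")
proof -
  let ?X = "H a b" and ?\<epsilon> = "Counit (R a) b"
  have i: "\<i>\<^bsub>V\<^esub> ?X \<in> hom V ?X ?X" and \<epsilon>: "?\<epsilon> \<in> hom A (?X \<star> a) b"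
    using objs by (simp_all add: hom_iff)
  have "uncurry ?s ?t ?l = uncurry ?s ?t (T \<I>\<^bsub>A\<^esub> a \<I>\<^bsub>A\<^esub> b \<cdot>\<^bsub>V\<^esub> (VIde E \<I>\<^bsub>A\<^esub> \<boxtimes>\<^bsub>V\<^esub> \<i>\<^bsub>V\<^esub> ?X))
      \<cdot>\<^bsub>A\<^esub> (inv_arr V (\<l>\<^bsub>V\<^esub> ?X) \<odot> \<i>\<^bsub>A\<^esub> ?s)"
    using objs by (subst uncurry_Comp[symmetric]) (auto simp: hom_iff)
  \<comment> \<open>Both factors are padded with identities so that the interchange law can separate
    the counit from the unit constraint.\<close>
  also have "\<dots> = (((\<i>\<^bsub>A\<^esub> \<I>\<^bsub>A\<^esub> \<cdot>\<^bsub>A\<^esub> \<lambda>\<lambda> \<I>\<^bsub>A\<^esub>) \<boxtimes>\<^bsub>A\<^esub> (?\<epsilon> \<cdot>\<^bsub>A\<^esub> \<i>\<^bsub>A\<^esub> (?X \<star> a))) \<cdot>\<^bsub>A\<^esub> \<xi>\<^bsub>op\<^esub> \<I>\<^bsub>V\<^esub> ?X \<I>\<^bsub>A\<^esub> a)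
      \<cdot>\<^bsub>A\<^esub> (inv_arr V (\<l>\<^bsub>V\<^esub> ?X) \<odot> \<i>\<^bsub>A\<^esub> ?s)"
    using objs
    by (subst uncurry_T_TensA[OF _ _ _ _ VIde_enriched_hom i]) (simp_all add: uncurry_VIde uncurry_Ide)
  also have "\<dots> = (\<i>\<^bsub>A\<^esub> \<I>\<^bsub>A\<^esub> \<boxtimes>\<^bsub>A\<^esub> ?\<epsilon>) \<cdot>\<^bsub>A\<^esub> (\<lambda>\<lambda> \<I>\<^bsub>A\<^esub> \<boxtimes>\<^bsub>A\<^esub> \<i>\<^bsub>A\<^esub> (?X \<star> a)) \<cdot>\<^bsub>A\<^esub> \<xi>\<^bsub>op\<^esub> \<I>\<^bsub>V\<^esub> ?X \<I>\<^bsub>A\<^esub> a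
      \<cdot>\<^bsub>A\<^esub> (inv_arr V (\<l>\<^bsub>V\<^esub> ?X) \<odot> \<i>\<^bsub>A\<^esub> ?s)"
    using objs by (simp del: acted.Comp_Ide_Dom acted.Ide_Comp_Cod flip: acted.TensA_Comp)
  finally have "\<l>\<^bsub>A\<^esub> b \<cdot>\<^bsub>A\<^esub> uncurry ?s ?t ?l
      = (\<l>\<^bsub>A\<^esub> b \<cdot>\<^bsub>A\<^esub> (\<i>\<^bsub>A\<^esub> \<I>\<^bsub>A\<^esub> \<boxtimes>\<^bsub>A\<^esub> ?\<epsilon>)) \<cdot>\<^bsub>A\<^esub> (\<lambda>\<lambda> \<I>\<^bsub>A\<^esub> \<boxtimes>\<^bsub>A\<^esub> \<i>\<^bsub>A\<^esub> (?X \<star> a)) \<cdot>\<^bsub>A\<^esub> \<xi>\<^bsub>op\<^esub> \<I>\<^bsub>V\<^esub> ?X \<I>\<^bsub>A\<^esub> a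
      \<cdot>\<^bsub>A\<^esub> (inv_arr V (\<l>\<^bsub>V\<^esub> ?X) \<odot> \<i>\<^bsub>A\<^esub> ?s)"
    using objs by simp
  also have "\<dots> = ?\<epsilon> \<cdot>\<^bsub>A\<^esub> (\<l>\<^bsub>A\<^esub> (?X \<star> a) \<cdot>\<^bsub>A\<^esub> (\<lambda>\<lambda> \<I>\<^bsub>A\<^esub> \<boxtimes>\<^bsub>A\<^esub> \<i>\<^bsub>A\<^esub> (?X \<star> a)) \<cdot>\<^bsub>A\<^esub> \<xi>\<^bsub>op\<^esub> \<I>\<^bsub>V\<^esub> ?X \<I>\<^bsub>A\<^esub> a)
      \<cdot>\<^bsub>A\<^esub> (inv_arr V (\<l>\<^bsub>V\<^esub> ?X) \<odot> \<i>\<^bsub>A\<^esub> ?s)"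
    unfolding acted.LUnit_natural[OF \<epsilon>] using objs by simp
  also have "\<l>\<^bsub>A\<^esub> (?X \<star> a) \<cdot>\<^bsub>A\<^esub> (\<lambda>\<lambda> \<I>\<^bsub>A\<^esub> \<boxtimes>\<^bsub>A\<^esub> \<i>\<^bsub>A\<^esub> (?X \<star> a)) \<cdot>\<^bsub>A\<^esub> \<xi>\<^bsub>op\<^esub> \<I>\<^bsub>V\<^esub> ?X \<I>\<^bsub>A\<^esub> a = \<l>\<^bsub>V\<^esub> ?X \<odot> \<l>\<^bsub>A\<^esub> a"
    using objs by (simp add: Xi_left_unit flip: ActUnit_opmonoidal_unit)
  finally show ?thesis
    using objs by (simp add: ActA_Comp)
qed

text \<open>The mirror image, with naturality of \<open>\<r>\<close> and the right unit axiom for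
  \<open>\<xi>\<close>.\<close>

lemma VRUnit_natural:
  assumes objs: "a \<in> Obj A" "b \<in> Obj A"
  shows "\<r>\<^bsub>A\<^esub> b \<cdot>\<^bsub>A\<^esub> uncurry (a \<otimes>\<^bsub>A\<^esub> \<I>\<^bsub>A\<^esub>) (b \<otimes>\<^bsub>A\<^esub> \<I>\<^bsub>A\<^esub>)
        (T a \<I>\<^bsub>A\<^esub> b \<I>\<^bsub>A\<^esub> \<cdot>\<^bsub>V\<^esub> (\<i>\<^bsub>V\<^esub> (H a b) \<boxtimes>\<^bsub>V\<^esub> VIde E \<I>\<^bsub>A\<^esub>) \<cdot>\<^bsub>V\<^esub> inv_arr V (\<r>\<^bsub>V\<^esub> (H a b)))
    = Counit (R a) b \<cdot>\<^bsub>A\<^esub> (\<i>\<^bsub>V\<^esub> (H a b) \<odot> \<r>\<^bsub>A\<^esub> a)"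
    (is "_ \<cdot>\<^bsub>A\<^esub> uncurry ?s ?t ?l = _")
proof -
  let ?X = "H a b" and ?\<epsilon> = "Counit (R a) b"
  have i: "\<i>\<^bsub>V\<^esub> ?X \<in> hom V ?X ?X" and \<epsilon>: "?\<epsilon> \<in> hom A (?X \<star> a) b"
    using objs by (simp_all add: hom_iff)
  have "uncurry ?s ?t ?l = uncurry ?s ?t (T a \<I>\<^bsub>A\<^esub> b \<I>\<^bsub>A\<^esub> \<cdot>\<^bsub>V\<^esub> (\<i>\<^bsub>V\<^esub> ?X \<boxtimes>\<^bsub>V\<^esub> VIde E \<I>\<^bsub>A\<^esub>))
      \<cdot>\<^bsub>A\<^esub> (inv_arr V (\<r>\<^bsub>V\<^esub> ?X) \<odot> \<i>\<^bsub>A\<^esub> ?s)"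
    using objs by (subst uncurry_Comp[symmetric]) (auto simp: hom_iff)
  also have "\<dots> = (((?\<epsilon> \<cdot>\<^bsub>A\<^esub> \<i>\<^bsub>A\<^esub> (?X \<star> a)) \<boxtimes>\<^bsub>A\<^esub> (\<i>\<^bsub>A\<^esub> \<I>\<^bsub>A\<^esub> \<cdot>\<^bsub>A\<^esub> \<lambda>\<lambda> \<I>\<^bsub>A\<^esub>)) \<cdot>\<^bsub>A\<^esub> \<xi>\<^bsub>op\<^esub> ?X \<I>\<^bsub>V\<^esub> a \<I>\<^bsub>A\<^esub>)
      \<cdot>\<^bsub>A\<^esub> (inv_arr V (\<r>\<^bsub>V\<^esub> ?X) \<odot> \<i>\<^bsub>A\<^esub> ?s)"
    using objs
    by (subst uncurry_T_TensA[OF _ _ _ _ i VIde_enriched_hom]) (simp_all add: uncurry_VIde uncurry_Ide)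
  also have "\<dots> = (?\<epsilon> \<boxtimes>\<^bsub>A\<^esub> \<i>\<^bsub>A\<^esub> \<I>\<^bsub>A\<^esub>) \<cdot>\<^bsub>A\<^esub> (\<i>\<^bsub>A\<^esub> (?X \<star> a) \<boxtimes>\<^bsub>A\<^esub> \<lambda>\<lambda> \<I>\<^bsub>A\<^esub>) \<cdot>\<^bsub>A\<^esub> \<xi>\<^bsub>op\<^esub> ?X \<I>\<^bsub>V\<^esub> a \<I>\<^bsub>A\<^esub>
      \<cdot>\<^bsub>A\<^esub> (inv_arr V (\<r>\<^bsub>V\<^esub> ?X) \<odot> \<i>\<^bsub>A\<^esub> ?s)"
    using objs by (simp del: acted.Comp_Ide_Dom acted.Ide_Comp_Cod flip: acted.TensA_Comp)
  finally have "\<r>\<^bsub>A\<^esub> b \<cdot>\<^bsub>A\<^esub> uncurry ?s ?t ?l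
      = (\<r>\<^bsub>A\<^esub> b \<cdot>\<^bsub>A\<^esub> (?\<epsilon> \<boxtimes>\<^bsub>A\<^esub> \<i>\<^bsub>A\<^esub> \<I>\<^bsub>A\<^esub>)) \<cdot>\<^bsub>A\<^esub> (\<i>\<^bsub>A\<^esub> (?X \<star> a) \<boxtimes>\<^bsub>A\<^esub> \<lambda>\<lambda> \<I>\<^bsub>A\<^esub>) \<cdot>\<^bsub>A\<^esub> \<xi>\<^bsub>op\<^esub> ?X \<I>\<^bsub>V\<^esub> a \<I>\<^bsub>A\<^esub>
      \<cdot>\<^bsub>A\<^esub> (inv_arr V (\<r>\<^bsub>V\<^esub> ?X) \<odot> \<i>\<^bsub>A\<^esub> ?s)"
    using objs by simp
  also have "\<dots> = ?\<epsilon> \<cdot>\<^bsub>A\<^esub> (\<r>\<^bsub>A\<^esub> (?X \<star> a) \<cdot>\<^bsub>A\<^esub> (\<i>\<^bsub>A\<^esub> (?X \<star> a) \<boxtimes>\<^bsub>A\<^esub> \<lambda>\<lambda> \<I>\<^bsub>A\<^esub>) \<cdot>\<^bsub>A\<^esub> \<xi>\<^bsub>op\<^esub> ?X \<I>\<^bsub>V\<^esub> a \<I>\<^bsub>A\<^esub>)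
      \<cdot>\<^bsub>A\<^esub> (inv_arr V (\<r>\<^bsub>V\<^esub> ?X) \<odot> \<i>\<^bsub>A\<^esub> ?s)"
    unfolding acted.RUnit_natural[OF \<epsilon>] using objs by simp
  also have "\<r>\<^bsub>A\<^esub> (?X \<star> a) \<cdot>\<^bsub>A\<^esub> (\<i>\<^bsub>A\<^esub> (?X \<star> a) \<boxtimes>\<^bsub>A\<^esub> \<lambda>\<lambda> \<I>\<^bsub>A\<^esub>) \<cdot>\<^bsub>A\<^esub> \<xi>\<^bsub>op\<^esub> ?X \<I>\<^bsub>V\<^esub> a \<I>\<^bsub>A\<^esub> = \<r>\<^bsub>V\<^esub> ?X \<odot> \<r>\<^bsub>A\<^esub> a"
    using objs by (simp add: Xi_right_unit flip: ActUnit_opmonoidal_unit)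
  finally show ?thesis
    using objs by (simp add: ActA_Comp)
qed

lemma VAssoc_V_nat_iso:
  "V_nat_iso V (Vtensor_category V (Vtensor_category V E E) E) E
     (Vcompose V (VTens S) (Vtensor_functor V (VTens S) (Vid V E)))
     (Vcompose V (VTens S)
       (Vcompose V (Vtensor_functor V (Vid V E) (VTens S)) (Vassociator V E E E)))
     (\<lambda>((a, b), c). VAssoc S a b c)"
  by (rule V_nat_iso_name[where \<sigma> = "\<lambda>((a, b), c). \<a>\<^bsub>A\<^esub> a b c"])
    (auto simp: Vtensor_category_def Vcompose_def Vtensor_functor_def Vid_def Vassociator_def
      VAssoc_natural hom_iff intro!: iso_name)

text \<open>The identity \<open>V\<close>-functor transposes to the counit by
  \<open>uncurry_Ide\<close>, which gives the naturality condition the form proved in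
  \<open>VLUnit_natural\<close>.\<close>

lemma VLUnit_V_nat_iso:
  "V_nat_iso V E E (Vsection_left V E (VTens S) (VUnit S)) (Vid V E) (VLUnit S)"
  by (rule V_nat_iso_name[where \<sigma> = "LUnit A"])
    (auto simp: Vsection_left_def Vid_def VLUnit_natural uncurry_Ide hom_iff intro!: iso_name)

lemma VRUnit_V_nat_iso:
  "V_nat_iso V E E (Vsection_right V E (VTens S) (VUnit S)) (Vid V E) (VRUnit S)"
  by (rule V_nat_iso_name[where \<sigma> = "RUnit A"])
    (auto simp: Vsection_right_def Vid_def VRUnit_natural uncurry_Ide hom_iff intro!: iso_name)

lemma monoidal_V_category_induced: "monoidal_V_category V E S"
  by (intro monoidal_V_category.intro monoidal_V_category_axioms.intro
      base.braided_monoidal_category_axioms V_category_enriched VTens_V_functor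
      VAssoc_V_nat_iso VLUnit_V_nat_iso VRUnit_V_nat_iso transport.monoidal_category_target)
    simp

lemma monoidal_isomorphism_underlying:
  "monoidal_isomorphism A (underlying_monoidal V E S) (underlying_comparison V A act R)"
  unfolding underlying_comparison_def by (rule transport.monoidal_isomorphism_target)

end

theorem theorem3p6:
  fixes V :: "('v, 'm) braided_data"
    and A :: "('o, 'n) monoidal_data"
    and act :: "('v, 'm, 'o, 'n) action_data"
    and R :: "'o \<Rightarrow> ('v, 'm, 'o, 'n) right_adjoint_data"
    and op :: "('v, 'o, 'n) opmonoidal_data"
  assumes "braided_monoidal_category V"
    and "monoidal_category A"
    and "left_action V A act"
    and "\<And>a. a \<in> Obj A \<Longrightarrow> adjunction V A (act_on A act a) (R a)"
    and "opmonoidal_action V A act op"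
  shows "monoidal_V_category V (enriched_category V A act R) (induced_monoidal V A act R op) \<and>
         monoidal_isomorphism A
           (underlying_monoidal V (enriched_category V A act R) (induced_monoidal V A act R op))
           (underlying_comparison V A act R)"
proof -
  interpret closed_opmonoidal_action V A act R op
    using assms
    by (intro closed_opmonoidal_action.intro closed_action.intro closed_action_axioms.intro)
  show ?thesis
    using monoidal_V_category_induced monoidal_isomorphism_underlying by blast
qed

end
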